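(* Let $\Psi:\mathbb{R}^{np}\to\mathbb{R}$ be a symmetric gauge function, let $\mathscr{A}\in\mathcal{C}[0,\pi)$ (a tensor in $\mathbb{C}^{n\times n\times p}$), let $0\le r\le np$, and let $\widehat{\mathscr{E}}\in\mathcal{S}_{Tp}(\mathscr{A},r)$. Then $$\measuredangle_{\Psi}(\widehat{\mathscr{E}}^{-1}*\mathscr{A}*\widehat{\mathscr{E}}^{-1})=\Psi(\phi_{r+1}(\mathscr{A}),\ldots,\phi_{np}(\mathscr{A}),0,\ldots,0).$$ Consequently, $$\min_{\mathscr{E}}\Bigl\{\measuredangle_{\Psi}(\mathscr{E}^{-1}*\mathscr{A}*\mathscr{E}^{-1})\ \Big|\ \mathscr{E}\in\mathbb{C}^{n\times n\times p}\text{ sectorial},\ \mathscr{E}^{-1}*\mathscr{A}*\mathscr{E}^{-1}\in\mathcal{C}[0,\pi),\ \operatorname{Tprank}(\mathscr{E})\le r\Bigr\}=\Psi(\phi_{r+1}(\mathscr{A}),\ldots,\phi_{np}(\mathscr{A}),0,\ldots,0).$$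
   Context: T-product: for a third-order tensor $\mathscr{A}\in\mathbb{C}^{m\times n\times p}$ with frontal slices $A^{(1)},\dots,A^{(p)}$, $\operatorname{bcirc}(\mathscr{A})\in\mathbb{C}^{mp\times np}$ is the block-circulant matrix whose first block column is $A^{(1)},\dots,A^{(p)}$, $\operatorname{unfold}(\mathscr{A})$ is that first block column, $\operatorname{fold}$ is its inverse, and $\mathscr{A}*\mathscr{B}=\operatorname{fold}(\operatorname{bcirc}(\mathscr{A})\operatorname{unfold}(\mathscr{B}))$. $\operatorname{bcirc}$ is linear, injective and multiplicative; $\operatorname{bcirc}^{-1}$ denotes its inverse on block-circulant matrices. The T-inverse satisfies $\operatorname{bcirc}(\mathscr{A}^{-1})=\operatorname{bcirc}(\mathscr{A})^{-1}$. Canonical T-phases: $\mathscr{A}\in\mathbb{C}^{n\times n\times p}$ is sectorial if $0\notin W(\operatorname{bcirc}(\mathscr{A}))=\{x^H\operatorname{bcirc}(\mathscr{A})x:\ x\in\mathbb{C}^{np},\ \|x\|=1\}$. A sectorial tensor is T-invertible. For sectorial $\mathscr{A}$ one has a sectorial decomposition $\operatorname{bcirc}(\mathscr{A})=T^HDT$ with $T$ nonsingular and $D$ diagonal unitary. The diagonal entries of $D$ are written $e^{j\phi_k(\mathscr{A})}$ ($j=\sqrt{-1}$), with real arguments chosen and ordered so that $\phi_1(\mathscr{A})\ge\cdots\ge\phi_{np}(\mathscr{A})$, $\phi_1(\mathscr{A})-\phi_{np}(\mathscr{A})<\pi$ and $\frac12(\phi_1(\mathscr{A})+\phi_{np}(\mathscr{A}))\in(-\pi,\pi]$;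 the vector $\phi(\mathscr{A})=(\phi_1(\mathscr{A}),\dots,\phi_{np}(\mathscr{A}))$ is the canonical T-phase vector (independent of the decomposition). $\mathcal{C}[0,\pi)$ is the set of sectorial tensors in $\mathbb{C}^{n\times n\times p}$ all of whose canonical T-phases lie in $[0,\pi)$. T-phase rank: $\operatorname{Tprank}(\mathscr{A})=|\{i:\phi_i(\mathscr{A})\ne0\}|$ for sectorial $\mathscr{A}$. Gauges: a symmetric gauge function $\Psi:\mathbb{R}^{np}\to\mathbb{R}$ is a norm invariant under permutations and sign changes of coordinates. For sectorial $\mathscr{A}$, $\measuredangle_\Psi\mathscr{A}:=\Psi(\phi(\mathscr{A}))$. Half-phase truncations: let $\mathscr{A}$ be sectorial with a sectorial decomposition $\operatorname{bcirc}(\mathscr{A})=T^HDT$, $D=\operatorname{diag}(e^{j\phi_1(\mathscr{A})},\dots,e^{j\phi_{np}(\mathscr{A})})$ with phases in nonincreasing order. Put $D_{r/2}(\mathscr{A})=\operatorname{diag}(e^{j\phi_1(\mathscr{A})/2},\dots,e^{j\phi_r(\mathscr{A})/2},1,\dots,1)$ and $\mathscr{E}_{r/2}=\operatorname{bcirc}^{-1}(T^HD_{r/2}(\mathscr{A})T)$. $\mathcal{S}_{Tp}(\mathscr{A},r)$ is the set of all tensors $\mathscr{E}_{r/2}$ obtained from such decompositions for which $T^HD_{r/2}(\mathscr{A})T$ is block-circulant (so that $\operatorname{bcirc}^{-1}$ is defined). Such decompositions exist: with $F_p$ the unitary $p\times p$ DFT matrix, $\operatorname{bcirc}(\mathscr{A})=(F_p^H\otimes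 I_n)\operatorname{diag}(A_1,\dots,A_p)(F_p\otimes I_n)$, one takes matrix sectorial decompositions $A_i=T_i^HD_iT_i$ and $T=P^T\operatorname{diag}(T_1,\dots,T_p)(F_p\otimes I_n)$ with $P$ a permutation matrix sorting the phases globally. *)

theory Defs
  imports Complex_Main "HOL-Combinatorics.Permutations"
    "Jordan_Normal_Form.Schur_Decomposition"
begin

section \<open>Third-order tensors and the T-product\<close>

text \<open>A tensor of size \<open>m \<times> n \<times> p\<close> is the list \<open>[A\<^sup>1, \<dots>, A\<^sup>p]\<close> of its \<open>m \<times> n\<close> frontal slices.
  The size is read off from the list, so that everything below is meant for \<open>p > 0\<close>.
  All indices are 0-based.\<close>

type_synonym tensor = "complex mat list"

definition tensors :: "nat \<Rightarrow> nat \<Rightarrow> nat \<Rightarrow> tensor set" where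
  "tensors m n p = {A. length A = p \<and> set A \<subseteq> carrier_mat m n}"

definition t_rows :: "tensor \<Rightarrow> nat" where "t_rows A = dim_row (hd A)"
definition t_cols :: "tensor \<Rightarrow> nat" where "t_cols A = dim_col (hd A)"

text \<open>Block \<open>(a, b)\<close> of \<open>bcirc A\<close> is the frontal slice with (0-based) index \<open>(a - b) mod p\<close>.\<close>

definition bcirc :: "tensor \<Rightarrow> complex mat" where
  "bcirc A = (let m = t_rows A; n = t_cols A; p = length A in
     mat (m * p) (n * p)
       (\<lambda>(i, j). (A ! ((i div m + p - j div n) mod p)) $$ (i mod m, j mod n)))"

definition bcirc_inv :: "nat \<Rightarrow> nat \<Rightarrow> nat \<Rightarrow> complex mat \<Rightarrow> tensor" where
  "bcirc_inv m n p = the_inv_into (tensors m n p) bcirc"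

definition t_unfold :: "tensor \<Rightarrow> complex mat" where
  "t_unfold A = (let m = t_rows A in
     mat (m * length A) (t_cols A) (\<lambda>(i, j). (A ! (i div m)) $$ (i mod m, j)))"

definition t_fold :: "nat \<Rightarrow> complex mat \<Rightarrow> tensor" where
  "t_fold p M = (let m = dim_row M div p in
     map (\<lambda>k. mat m (dim_col M) (\<lambda>(i, j). M $$ (k * m + i, j))) [0..<p])"

definition t_prod :: "tensor \<Rightarrow> tensor \<Rightarrow> tensor" (infixl \<open>*\<^sub>T\<close> 70) where
  "A *\<^sub>T B = t_fold (length A) (bcirc A * t_unfold B)"

definition t_id :: "nat \<Rightarrow> nat \<Rightarrow> tensor" where
  "t_id n p = 1\<^sub>m n # replicate (p - 1) (0\<^sub>m n n)"

definition is_t_inverse :: "tensor \<Rightarrow> tensor \<Rightarrow> bool" where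
  "is_t_inverse A X \<longleftrightarrow> (let n = t_rows A; p = length A in
     X \<in> tensors n n p \<and> A *\<^sub>T X = t_id n p \<and> X *\<^sub>T A = t_id n p)"

definition t_invertible :: "tensor \<Rightarrow> bool" where
  "t_invertible A \<longleftrightarrow> (\<exists>X. is_t_inverse A X)"

definition t_inv :: "tensor \<Rightarrow> tensor" where
  "t_inv A = (THE X. is_t_inverse A X)"

lemma tensors_dims:
  assumes "A \<in> tensors m n p" "p > 0"
  shows "length A = p" "t_rows A = m" "t_cols A = n" "k < p \<Longrightarrow> A ! k \<in> carrier_mat m n"
proof -
  from assms have ne: "A \<noteq> []" and l: "length A = p" and s: "set A \<subseteq> carrier_mat m n"
    by (auto simp: tensors_def)
  then have "hd A \<in> carrier_mat m n" by auto
  with l s show "length A = p" "t_rows A = m" "t_cols A = n"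
    "k < p \<Longrightarrow> A ! k \<in> carrier_mat m n"
    by (auto simp: t_rows_def t_cols_def)
qed

lemma block_index_less: "k * m + i < m * p" if "k < p" "i < m" for k m i p :: nat
proof -
  have "k * m + i < (k + 1) * m" using that by simp
  also have "\<dots> \<le> p * m" using that by (intro mult_right_mono) auto
  finally show ?thesis by (simp add: mult.commute)
qed

lemma t_fold_unfold:
  assumes A: "A \<in> tensors m n p" and p: "p > 0"
  shows "t_fold p (t_unfold A) = A"
proof (rule nth_equalityI)
  note d = tensors_dims[OF A p]
  show "length (t_fold p (t_unfold A)) = length A" by (simp add: t_fold_def Let_def d)
  fix k assume "k < length (t_fold p (t_unfold A))"
  then have k: "k < p" by (simp add: t_fold_def Let_def)
  have Ak: "dim_row (A ! k) = m" "dim_col (A ! k) = n" using d(4)[OF k] by auto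
  show "t_fold p (t_unfold A) ! k = A ! k"
    by (rule eq_matI)
      (use p k block_index_less[OF k] Ak in \<open>simp_all add: t_fold_def t_unfold_def Let_def d\<close>)
qed

lemma t_unfold_fold:
  assumes M: "M \<in> carrier_mat (m * p) n" and p: "p > 0"
  shows "t_fold p M \<in> tensors m n p" "t_unfold (t_fold p M) = M"
proof -
  show T: "t_fold p M \<in> tensors m n p"
    using M p by (auto simp: t_fold_def tensors_def Let_def)
  note d = tensors_dims[OF T p]
  show "t_unfold (t_fold p M) = M"
  proof (rule eq_matI)
    fix i j assume "i < dim_row M" "j < dim_col M"
    then have ij: "i < m * p" "j < n" using M by auto
    then have m: "m > 0" by (cases m) auto
    have "i div m < p" using ij m by (simp add: less_mult_imp_div_less mult.commute)
    moreover have "i mod m < m" using m by simp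
    ultimately show "t_unfold (t_fold p M) $$ (i, j) = M $$ (i, j)"
      using M p ij by (simp add: t_unfold_def Let_def d) (simp add: t_fold_def Let_def)
  qed (use M in \<open>auto simp: t_unfold_def Let_def d\<close>)
qed

lemma bcirc_inj_on:
  assumes p: "p > 0" and n: "n > 0"
  shows "inj_on bcirc (tensors m n p)"
proof (rule inj_onI)
  fix A B assume A: "A \<in> tensors m n p" and B: "B \<in> tensors m n p" and eq: "bcirc A = bcirc B"
  note dA = tensors_dims[OF A p] and dB = tensors_dims[OF B p]
  show "A = B"
  proof (rule nth_equalityI)
    show "length A = length B" using dA dB by simp
    fix k assume "k < length A"
    then have k: "k < p" using dA by simp
    show "A ! k = B ! k"
    proof (rule eq_matI)
      fix i j assume "i < dim_row (B ! k)" "j < dim_col (B ! k)"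
      then have ij: "i < m" "j < n" using dB(4)[OF k] by auto
      have jp: "j < n * p" using ij(2) p by (metis less_le_trans mult_le_mono2 Suc_leI mult_1_right One_nat_def)
      have "bcirc A $$ (k * m + i, j) = bcirc B $$ (k * m + i, j)" using eq by simp
      then show "A ! k $$ (i, j) = B ! k $$ (i, j)"
        using ij jp k block_index_less[OF k ij(1)] by (simp add: bcirc_def Let_def dA dB)
    qed (use dA(4)[OF k] dB(4)[OF k] in auto)
  qed
qed


section \<open>Sectorial tensors and canonical T-phases\<close>

text \<open>For vectors, \<open>(M *\<^sub>v x) \<bullet>c x\<close> is \<open>x\<^sup>H M x\<close>, and \<open>x \<bullet>c x\<close> is the square of the norm of \<open>x\<close>.\<close>

definition numerical_range :: "complex mat \<Rightarrow> complex set" where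
  "numerical_range M = {(M *\<^sub>v x) \<bullet>c x | x. x \<in> carrier_vec (dim_row M) \<and> x \<bullet>c x = 1}"

definition t_sectorial :: "tensor \<Rightarrow> bool" where
  "t_sectorial A \<longleftrightarrow> 0 \<notin> numerical_range (bcirc A)"

text \<open>\<open>sectorial_decomp M T d\<close>: \<open>M = T\<^sup>H D T\<close> with \<open>T\<close> nonsingular and
  \<open>D = diag(exp(\<i> d\<^sub>0), exp(\<i> d\<^sub>1), \<dots>)\<close>, the general form of a diagonal unitary matrix.\<close>

definition sectorial_decomp :: "complex mat \<Rightarrow> complex mat \<Rightarrow> real vec \<Rightarrow> bool" where
  "sectorial_decomp M T d \<longleftrightarrow> (let N = dim_row M in
     T \<in> carrier_mat N N \<and> invertible_mat T \<and> d \<in> carrier_vec N \<and>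
     M = mat_adjoint T * mat_diag N (\<lambda>i. cis (d $ i)) * T)"

text \<open>Canonical choice and ordering of the arguments. The first and the last entry are the
  largest and the smallest one.\<close>

definition canonical_args :: "real vec \<Rightarrow> bool" where
  "canonical_args d \<longleftrightarrow> (let N = dim_vec d in
     (\<forall>i j. i \<le> j \<longrightarrow> j < N \<longrightarrow> d $ j \<le> d $ i) \<and>
     d $ 0 - d $ (N - 1) < pi \<and>
     - pi < (d $ 0 + d $ (N - 1)) / 2 \<and> (d $ 0 + d $ (N - 1)) / 2 \<le> pi)"

text \<open>Only meaningful for sectorial \<open>A\<close>, for which the phase vector exists and does not depend
  on the decomposition.\<close>

definition t_phases :: "tensor \<Rightarrow> real vec" where
  "t_phases A = (THE d. canonical_args d \<and> (\<exists>T. sectorial_decomp (bcirc A) T d))"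

definition C_0_pi :: "nat \<Rightarrow> nat \<Rightarrow> tensor set" where
  "C_0_pi n p = {A \<in> tensors n n p. t_sectorial A \<and>
     (\<forall>i < n * p. 0 \<le> t_phases A $ i \<and> t_phases A $ i < pi)}"

definition Tprank :: "tensor \<Rightarrow> nat" where
  "Tprank A = card {i. i < dim_vec (t_phases A) \<and> t_phases A $ i \<noteq> 0}"


section \<open>Symmetric gauge functions\<close>

definition symmetric_gauge :: "nat \<Rightarrow> (real vec \<Rightarrow> real) \<Rightarrow> bool" where
  "symmetric_gauge N \<Psi> \<longleftrightarrow>
     (\<forall>v \<in> carrier_vec N. 0 \<le> \<Psi> v) \<and>
     (\<forall>v \<in> carrier_vec N. \<Psi> v = 0 \<longleftrightarrow> v = 0\<^sub>v N) \<and>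
     (\<forall>v \<in> carrier_vec N. \<forall>c. \<Psi> (c \<cdot>\<^sub>v v) = \<bar>c\<bar> * \<Psi> v) \<and>
     (\<forall>v \<in> carrier_vec N. \<forall>w \<in> carrier_vec N. \<Psi> (v + w) \<le> \<Psi> v + \<Psi> w) \<and>
     (\<forall>v \<in> carrier_vec N. \<forall>\<pi>. \<pi> permutes {..<N} \<longrightarrow> \<Psi> (vec N (\<lambda>i. v $ \<pi> i)) = \<Psi> v) \<and>
     (\<forall>v \<in> carrier_vec N. \<forall>s. (\<forall>i<N. s i = 1 \<or> s i = - 1) \<longrightarrow>
        \<Psi> (vec N (\<lambda>i. s i * v $ i)) = \<Psi> v)"

definition t_angle :: "(real vec \<Rightarrow> real) \<Rightarrow> tensor \<Rightarrow> real" where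
  "t_angle \<Psi> A = \<Psi> (t_phases A)"

definition is_minimum :: "real set \<Rightarrow> real \<Rightarrow> bool" where
  "is_minimum S x \<longleftrightarrow> x \<in> S \<and> (\<forall>y \<in> S. x \<le> y)"

text \<open>\<open>drop_pad r v\<close> is \<open>(v\<^sub>r, \<dots>, v\<^sub>N\<^sub>-\<^sub>1, 0, \<dots>, 0)\<close>, with \<open>r\<close> trailing zeros.\<close>

definition drop_pad :: "nat \<Rightarrow> real vec \<Rightarrow> real vec" where
  "drop_pad r v = vec (dim_vec v) (\<lambda>i. if i + r < dim_vec v then v $ (i + r) else 0)"


section \<open>Half-phase truncations\<close>

definition half_phase_diag :: "nat \<Rightarrow> real vec \<Rightarrow> complex mat" where
  "half_phase_diag r d = mat_diag (dim_vec d) (\<lambda>i. if i < r then cis (d $ i / 2) else 1)"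

definition S_Tp :: "nat \<Rightarrow> nat \<Rightarrow> tensor \<Rightarrow> nat \<Rightarrow> tensor set" where
  "S_Tp n p A r =
     {bcirc_inv n n p (mat_adjoint T * half_phase_diag r (t_phases A) * T) | T.
        sectorial_decomp (bcirc A) T (t_phases A) \<and>
        mat_adjoint T * half_phase_diag r (t_phases A) * T \<in> bcirc ` tensors n n p}"

end

theory Submission
  imports Defs "HOL-Computational_Algebra.Fundamental_Theorem_Algebra"
begin

text \<open>
  Block-circulant matrices are exactly the matrices commuting with the cyclic block shift \<open>S\<close>, which
  is unitary. For sectorial \<open>M\<close> commuting with \<open>S\<close>, joint eigenvectors of \<open>M\<^sup>-\<^sup>H M\<close> and \<open>S\<close>, chosen one
  after another in the subspace \<open>{y. \<forall>i. x\<^sub>i\<^sup>H M y = 0}\<close>, give \<open>M = T\<^sup>H D T\<close> with \<open>T S T\<^sup>-\<^sup>1\<close> diagonal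
  unitary. Then \<open>T\<^sup>H D' T\<close> is block-circulant for every diagonal \<open>D'\<close>; no Fourier transform is needed.

  For the lower bound put \<open>B = E\<^sup>-\<^sup>1 A E\<^sup>-\<^sup>1\<close>, so that \<open>A = E B E\<close>. If \<open>E\<close> has at most \<open>r\<close> nonzero phases then
  \<open>E x = E\<^sup>H x\<close>, hence \<open>x\<^sup>H A x = (E x)\<^sup>H B (E x)\<close>, on a subspace of codimension at most \<open>r\<close>. A
  Courant--Fischer dimension count now gives \<open>\<phi>\<^sub>i\<^sub>+\<^sub>r(A) \<le> \<phi>\<^sub>i(B)\<close>, and symmetric gauge functions are
  monotone on nonnegative vectors. The same interlacing with \<open>r = 0\<close> shows that the canonical phases
  do not depend on the decomposition.
\<close>

section \<open>Adjoints and inverses\<close>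

text \<open>If \<open>M = T^H D T\<close>, then \<open>M^-H M = T^-1 D^2 T\<close>, so the
  eigenvectors in question are the columns of \<open>T^-1\<close>. Eigenvalues may repeat, and
  eigenvectors picked independently need not be orthogonal for the form of \<open>M\<close>; this
  forces the choice inside successive complements. Block-circulance of \<open>T^H D T\<close> alone
  says nothing about \<open>T^H D' T\<close> with halved phases, so \<open>T\<close> itself has to
  be adapted to \<open>S\<close>. Only then is a truncation certain to exist and the minimum
  attained.

  \<open>E^-1 A E^-1\<close> is in general not a congruence of \<open>A\<close>, since neither
  factor is the adjoint of the other. For a half-phase truncation with \<open>X = T^-1\<close> and
  \<open>G\<close> the inverse of the halved diagonal it equals \<open>X (G D G) X^H\<close>, and
  \<open>G D G\<close> has its first \<open>r\<close> phases erased. For other \<open>E\<close> a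
  comparison of forms survives only on a subspace.

  The range \<open>[0, pi)\<close> matters twice: the phases of \<open>A\<close> and of
  \<open>B\<close> differ by less than pi, so that signs of sines can compare them, and zero is the
  smallest possible phase, so that a vector padded with zeros at its end is still sorted.\<close>

lemma common_kernel_vector:
  fixes K :: "'a::field vec set"
  assumes fin: "finite K" and card: "card K < N" and K: "K \<subseteq> carrier_vec N"
  shows "\<exists>x\<in>carrier_vec N. x \<noteq> 0\<^sub>v N \<and> (\<forall>v\<in>K. v \<bullet> x = 0)"
proof -
  obtain vs where vs: "set vs = K" "distinct vs" using finite_distinct_list[OF fin] by auto
  then have len: "length vs < N" using card distinct_card by fastforce
  let ?c = "\<lambda>i. if i < length vs then vs ! i else 0\<^sub>v N"
  \<comment> \<open>Padding the fewer than \<open>N\<close> vectors with zero rows gives a singular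
    square matrix. The test for row \<open>length vs\<close> puts it in the shape that
    \<open>det_row_0\<close> expects. All later dimension counts rest on this.\<close>
  let ?A = "mat\<^sub>r N N (\<lambda>i. if i = length vs then 0\<^sub>v N else ?c i)"
  have "vs ! i \<in> carrier_vec N" if "i < length vs" for i by (rule subsetD[OF K]) (use nth_mem[OF that] vs(1) in simp)
  then have c: "?c \<in> {0..<N} \<rightarrow> carrier_vec N" by (intro Pi_I) simp
  have A: "?A \<in> carrier_mat N N" by (rule mat_row_carrierI)
  have "det ?A = 0" by (rule det_row_0[OF len c])
  then obtain x where x: "x \<in> carrier_vec N" "x \<noteq> 0\<^sub>v N" "?A *\<^sub>v x = 0\<^sub>v N"
    unfolding det_0_iff_vec_prod_zero[OF A] by blast
  have "v \<bullet> x = 0" if "v \<in> K" for v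
  proof -
    obtain i where i: "i < length vs" "vs ! i = v" using \<open>v \<in> K\<close> unfolding vs(1)[symmetric] in_set_conv_nth by blast
    have iN: "i < N" and vN: "v \<in> carrier_vec N" using i(1) len subsetD[OF K \<open>v \<in> K\<close>] by simp_all
    have "row ?A i = v" using row_mat_of_row_fun[OF iN, of "\<lambda>i. if i = length vs then 0\<^sub>v N else ?c i"] i vN by simp
    then have "v \<bullet> x = (?A *\<^sub>v x) $ i" using index_mult_mat_vec[of i ?A x] A iN by (simp del: index_mult_mat_vec)
    also have "\<dots> = 0" unfolding x(3) using iN by simp
    finally show ?thesis .
  qed
  with x show ?thesis by blast
qed

lemma mat_adjoint_carrier: "A \<in> carrier_mat N N \<Longrightarrow> mat_adjoint A \<in> carrier_mat N N"
  by (auto simp: mat_adjoint_def)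

lemma mat_adjoint_index:
  fixes A :: "complex mat"
  assumes "A \<in> carrier_mat N N" "i < N" "j < N"
  shows "mat_adjoint A $$ (i, j) = cnj (A $$ (j, i))"
  using assms by (auto simp: mat_adjoint_def mat_of_rows_index)

lemma mat_adjoint_adjoint:
  fixes A :: "complex mat"
  assumes "A \<in> carrier_mat N N"
  shows "mat_adjoint (mat_adjoint A) = A"
  using assms mat_adjoint_carrier[OF assms] mat_adjoint_carrier[OF mat_adjoint_carrier[OF assms]]
  by (intro eq_matI) (auto simp: mat_adjoint_index)

lemma mat_adjoint_mult:
  fixes A :: "complex mat"
  assumes "A \<in> carrier_mat N N" "B \<in> carrier_mat N N"
  shows "mat_adjoint (A * B) = mat_adjoint B * mat_adjoint A"
proof (rule eq_matI)
  have AB: "A * B \<in> carrier_mat N N" using assms by simp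
  note cs = assms AB mat_adjoint_carrier[OF assms(1)] mat_adjoint_carrier[OF assms(2)]
    mat_adjoint_carrier[OF AB]
  show "dim_row (mat_adjoint (A * B)) = dim_row (mat_adjoint B * mat_adjoint A)"
    "dim_col (mat_adjoint (A * B)) = dim_col (mat_adjoint B * mat_adjoint A)"
    using cs by auto
  fix i j assume "i < dim_row (mat_adjoint B * mat_adjoint A)" "j < dim_col (mat_adjoint B * mat_adjoint A)"
  then have ij: "i < N" "j < N" using cs by auto
  have "mat_adjoint (A * B) $$ (i, j) = cnj ((A * B) $$ (j, i))"
    by (rule mat_adjoint_index[OF AB ij])
  also have "\<dots> = (\<Sum>k\<in>{0..<N}. cnj (A $$ (j, k)) * cnj (B $$ (k, i)))"
    using cs ij by (simp add: scalar_prod_def)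
  also have "\<dots> = (\<Sum>k\<in>{0..<N}. mat_adjoint B $$ (i, k) * mat_adjoint A $$ (k, j))"
    using assms ij by (intro sum.cong) (simp_all add: mat_adjoint_index)
  also have "\<dots> = (mat_adjoint B * mat_adjoint A) $$ (i, j)"
    using cs ij by (simp add: scalar_prod_def)
  finally show "mat_adjoint (A * B) $$ (i, j) = (mat_adjoint B * mat_adjoint A) $$ (i, j)" .
qed

lemma mat_adjoint_one: "mat_adjoint (1\<^sub>m N :: complex mat) = 1\<^sub>m N"
  using mat_adjoint_carrier[OF one_carrier_mat[of N, where 'a = complex]]
  by (intro eq_matI) (auto simp: mat_adjoint_index[OF one_carrier_mat])

lemma mat_diag_index:
  assumes "i < N" "j < N"
  shows "mat_diag N f $$ (i, j) = (if i = j then f j else 0)"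
  using assms by (simp add: mat_diag_def)

lemma mat_adjoint_mat_diag: "mat_adjoint (mat_diag N f) = mat_diag N (\<lambda>i. cnj (f i))"
proof (rule eq_matI)
  have D: "mat_diag N f \<in> carrier_mat N N" by simp
  fix i j assume "i < dim_row (mat_diag N (\<lambda>i. cnj (f i)))" "j < dim_col (mat_diag N (\<lambda>i. cnj (f i)))"
  then have "i < N" "j < N" by (simp_all add: mat_diag_def)
  then show "mat_adjoint (mat_diag N f) $$ (i, j) = mat_diag N (\<lambda>i. cnj (f i)) $$ (i, j)"
    by (simp add: mat_adjoint_index[OF D] mat_diag_index)
qed (simp_all add: mat_adjoint_def mat_diag_def)

lemma cscalar_adjoint:
  fixes A :: "complex mat"
  assumes A: "A \<in> carrier_mat N N" and u: "u \<in> carrier_vec N" and v: "v \<in> carrier_vec N"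
  shows "(A *\<^sub>v u) \<bullet>c v = u \<bullet>c (mat_adjoint A *\<^sub>v v)"
proof -
  have "(A *\<^sub>v u) \<bullet>c v = (\<Sum>i\<in>{0..<N}. (\<Sum>j\<in>{0..<N}. A $$ (i, j) * u $ j) * cnj (v $ i))"
    using A u v by (simp add: scalar_prod_def)
  also have "\<dots> = (\<Sum>j\<in>{0..<N}. \<Sum>i\<in>{0..<N}. A $$ (i, j) * u $ j * cnj (v $ i))"
    by (simp add: sum_distrib_right, rule sum.swap)
  also have "\<dots> = (\<Sum>j\<in>{0..<N}. u $ j * cnj (\<Sum>i\<in>{0..<N}. mat_adjoint A $$ (j, i) * v $ i))"
    using A by (intro sum.cong) (simp_all add: mat_adjoint_index sum_distrib_left mult_ac)
  also have "\<dots> = u \<bullet>c (mat_adjoint A *\<^sub>v v)"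
    using mat_adjoint_carrier[OF A] u v by (simp add: scalar_prod_def)
  finally show ?thesis .
qed

lemma cscalar_commute:
  fixes u v :: "complex vec"
  assumes "u \<in> carrier_vec N" "v \<in> carrier_vec N"
  shows "u \<bullet>c v = cnj (v \<bullet>c u)"
  using assms by (auto simp: scalar_prod_def intro!: sum.cong)

lemma cscalar_smult_right:
  fixes u v :: "complex vec"
  assumes "u \<in> carrier_vec N" "v \<in> carrier_vec N"
  shows "u \<bullet>c (a \<cdot>\<^sub>v v) = cnj a * (u \<bullet>c v)"
  using assms by (simp add: conjugate_smult_vec)

lemma det_nonzero_obtain_inverse:
  fixes A :: "'a::field mat"
  assumes A: "A \<in> carrier_mat N N" and inj: "\<And>x. x \<in> carrier_vec N \<Longrightarrow> A *\<^sub>v x = 0\<^sub>v N \<Longrightarrow> x = 0\<^sub>v N"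
  obtains B where "B \<in> carrier_mat N N" "A * B = 1\<^sub>m N" "B * A = 1\<^sub>m N"
proof -
  have "det A \<noteq> 0" using det_0_iff_vec_prod_zero[OF A] inj by auto
  from det_non_zero_imp_unit[OF A this, of "()"] show ?thesis
    using that unfolding Units_def ring_mat_def by auto
qed

section \<open>Joint eigenvectors in invariant subspaces\<close>

text \<open>Linear subspaces as bare sets, so that no basis has to be chosen. Zero is
  \<open>0\<close> times any element; nontriviality is always supplied by a nonzero vector of
  \<open>W\<close>.\<close>

definition lin_closed :: "nat \<Rightarrow> complex vec set \<Rightarrow> bool" where
  "lin_closed N W \<longleftrightarrow> W \<subseteq> carrier_vec N \<and> (\<forall>u\<in>W. \<forall>v\<in>W. u + v \<in> W) \<and> (\<forall>a. \<forall>u\<in>W. a \<cdot>\<^sub>v u \<in> W)"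

text \<open>This is \<open>q(C) w\<close> as soon as \<open>degree q < m\<close>. The explicit
  cut-off \<open>m\<close> serves as induction parameter, and working coordinatewise replaces sums
  of vectors by sums of numbers.\<close>

definition krylov_comb :: "complex mat \<Rightarrow> complex vec \<Rightarrow> nat \<Rightarrow> complex poly \<Rightarrow> complex vec" where
  "krylov_comb C w m q =
     vec (dim_vec w) (\<lambda>i. \<Sum>k<m. coeff q k * (((\<lambda>u. C *\<^sub>v u) ^^ k) w) $ i)"

lemma krylov_power_in:
  assumes "w \<in> W" "\<And>u. u \<in> W \<Longrightarrow> C *\<^sub>v u \<in> W"
  shows "((\<lambda>u. C *\<^sub>v u) ^^ k) w \<in> W"
  using assms by (induction k) auto

lemma krylov_comb_in:
  assumes W: "lin_closed N W" and w: "w \<in> W" and inv: "\<And>u. u \<in> W \<Longrightarrow> C *\<^sub>v u \<in> W"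
  shows "krylov_comb C w m q \<in> W"
proof (induction m)
  have wN: "w \<in> carrier_vec N" using W w by (auto simp: lin_closed_def)
  case 0
  have "krylov_comb C w 0 q = 0 \<cdot>\<^sub>v w" using wN by (auto simp: krylov_comb_def)
  with W w show ?case by (auto simp: lin_closed_def)
next
  case (Suc m)
  let ?u = "((\<lambda>u. C *\<^sub>v u) ^^ m) w"
  have u: "?u \<in> W" by (rule krylov_power_in[OF w inv])
  have "dim_vec ?u = N" "dim_vec w = N" using W w u by (auto simp: lin_closed_def)
  then have "krylov_comb C w (Suc m) q = krylov_comb C w m q + coeff q m \<cdot>\<^sub>v ?u"
    by (intro eq_vecI) (auto simp: krylov_comb_def)
  with W Suc u show ?case by (auto simp: lin_closed_def)
qed

text \<open>Multiplying the polynomial by \<open>t - l\<close> applies \<open>C - l I\<close> to the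
  vector. The degree bound makes \<open>coeff q m\<close> vanish, so that raising the cut-off to
  \<open>Suc m\<close> adds nothing to the part \<open>l * q\<close>.\<close>

lemma krylov_comb_shift:
  assumes C: "C \<in> carrier_mat N N" and w: "w \<in> carrier_vec N" and deg: "degree q < m"
  shows "krylov_comb C w (Suc m) ([:- l, 1:] * q) =
    C *\<^sub>v krylov_comb C w m q - l \<cdot>\<^sub>v krylov_comb C w m q"
proof (rule eq_vecI)
  let ?p = "\<lambda>k. ((\<lambda>u. C *\<^sub>v u) ^^ k) w"
  have p: "?p k \<in> carrier_vec N" for k
    using C w by (intro krylov_power_in) auto
  show "dim_vec (krylov_comb C w (Suc m) ([:- l, 1:] * q)) =
    dim_vec (C *\<^sub>v krylov_comb C w m q - l \<cdot>\<^sub>v krylov_comb C w m q)"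
    using C w by (simp add: krylov_comb_def)
  fix i assume "i < dim_vec (C *\<^sub>v krylov_comb C w m q - l \<cdot>\<^sub>v krylov_comb C w m q)"
  then have i: "i < N" using w by (simp add: krylov_comb_def)
  have cm: "coeff q m = 0" using deg by (simp add: coeff_eq_0)
  have "(\<Sum>k<Suc m. coeff (pCons 0 q) k * ?p k $ i) = (\<Sum>k<m. coeff q k * ?p (Suc k) $ i)"
    by (subst sum.lessThan_Suc_shift) simp
  also have "\<dots> = (\<Sum>k<m. coeff q k * (\<Sum>j\<in>{0..<N}. C $$ (i, j) * ?p k $ j))"
    using C i carrier_vecD[OF p] by (intro sum.cong) (auto simp: scalar_prod_def)
  also have "\<dots> = (\<Sum>j\<in>{0..<N}. C $$ (i, j) * (\<Sum>k<m. coeff q k * ?p k $ j))"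
    by (simp add: sum_distrib_left mult_ac, rule sum.swap)
  also have "\<dots> = (C *\<^sub>v krylov_comb C w m q) $ i"
    using C w i by (simp add: krylov_comb_def scalar_prod_def)
  finally have 1: "(\<Sum>k<Suc m. coeff (pCons 0 q) k * ?p k $ i) = (C *\<^sub>v krylov_comb C w m q) $ i" .
  have 2: "(\<Sum>k<Suc m. coeff q k * ?p k $ i) = krylov_comb C w m q $ i"
    using cm w i by (simp add: krylov_comb_def)
  have "krylov_comb C w (Suc m) ([:- l, 1:] * q) $ i =
     (\<Sum>k<Suc m. (coeff (pCons 0 q) k - l * coeff q k) * ?p k $ i)"
    using w i by (simp add: krylov_comb_def del: sum.lessThan_Suc)
  also have "\<dots> = (\<Sum>k<Suc m. coeff (pCons 0 q) k * ?p k $ i - l * (coeff q k * ?p k $ i))"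
    by (intro sum.cong) (simp_all add: left_diff_distrib)
  also have "\<dots> = (\<Sum>k<Suc m. coeff (pCons 0 q) k * ?p k $ i) - l * (\<Sum>k<Suc m. coeff q k * ?p k $ i)"
    by (simp only: sum_subtractf sum_distrib_left)
  also have "\<dots> = (C *\<^sub>v krylov_comb C w m q - l \<cdot>\<^sub>v krylov_comb C w m q) $ i"
    unfolding 1 2 using w i by (simp add: krylov_comb_def)
  finally show "krylov_comb C w (Suc m) ([:- l, 1:] * q) $ i =
    (C *\<^sub>v krylov_comb C w m q - l \<cdot>\<^sub>v krylov_comb C w m q) $ i" .
qed

text \<open>The \<open>N + 1\<close> vectors \<open>w, C w, ..., C^N w\<close> are dependent in
  dimension \<open>N\<close>. Each coordinate is one linear condition on the \<open>N + 1\<close>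
  coefficients, and a common zero of these conditions is the coefficient list of
  \<open>q\<close>.\<close>

lemma krylov_comb_annihilator:
  assumes w: "w \<in> carrier_vec N"
  shows "\<exists>q. q \<noteq> 0 \<and> degree q \<le> N \<and> krylov_comb C w (Suc N) q = 0\<^sub>v N"
proof -
  let ?p = "\<lambda>k. ((\<lambda>u. C *\<^sub>v u) ^^ k) w"
  let ?K = "(\<lambda>i. vec (Suc N) (\<lambda>k. ?p k $ i)) ` {..<N}"
  have "finite ?K" "?K \<subseteq> carrier_vec (Suc N)" by auto
  moreover have "card ?K < Suc N" using card_image_le[of "{..<N}" "\<lambda>i. vec (Suc N) (\<lambda>k. ?p k $ i)"] by (simp add: le_imp_less_Suc)
  ultimately obtain x where x: "x \<in> carrier_vec (Suc N)" "x \<noteq> 0\<^sub>v (Suc N)" "\<forall>v\<in>?K. v \<bullet> x = 0"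
    using common_kernel_vector[of ?K "Suc N"] by blast
  define q where "q = Poly (list_of_vec x)"
  have cq: "coeff q k = (if k < Suc N then x $ k else 0)" for k
    using x(1) unfolding q_def by (auto simp: nth_default_def list_of_vec_index)
  have "q \<noteq> 0"
  proof
    assume "q = 0"
    then have "x $ k = 0" if "k < Suc N" for k using cq[of k] that by simp
    then have "x = 0\<^sub>v (Suc N)" using x(1) by (intro eq_vecI) auto
    with x(2) show False by simp
  qed
  moreover have "degree q \<le> N" using cq by (intro degree_le) auto
  moreover have "krylov_comb C w (Suc N) q = 0\<^sub>v N"
  proof (rule eq_vecI)
    fix i assume "i < dim_vec (0\<^sub>v N :: complex vec)"
    then have i: "i < N" by simp
    then have "vec (Suc N) (\<lambda>k. ?p k $ i) \<bullet> x = 0" using x(3) by auto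
    moreover have "vec (Suc N) (\<lambda>k. ?p k $ i) \<bullet> x = (\<Sum>k<Suc N. coeff q k * ?p k $ i)"
      using x(1) unfolding scalar_prod_def by (intro sum.cong) (auto simp: cq)
    ultimately show "krylov_comb C w (Suc N) q $ i = 0\<^sub>v N $ i"
      using i w by (simp add: krylov_comb_def del: sum.lessThan_Suc)
  qed (use w in \<open>simp add: krylov_comb_def\<close>)
  ultimately show ?thesis by blast
qed

text \<open>Roots are split off an annihilating polynomial of \<open>w\<close> one at a time. If
  \<open>q = (t - l) q'\<close>, then \<open>q'(C) w\<close> is either an eigenvector for
  \<open>l\<close> or zero, and in the latter case \<open>q'\<close> annihilates \<open>w\<close>
  with smaller degree. A nonzero constant cannot annihilate \<open>w\<close>, so the descent meets
  an eigenvector, and it lies in \<open>W\<close> as a combination of the iterates of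
  \<open>w\<close>.\<close>

lemma eigenvector_in_invariant_subspace:
  assumes C: "C \<in> carrier_mat N N" and W: "lin_closed N W"
    and inv: "\<And>u. u \<in> W \<Longrightarrow> C *\<^sub>v u \<in> W" and w: "w \<in> W" "w \<noteq> 0\<^sub>v N"
  shows "\<exists>x\<in>W. x \<noteq> 0\<^sub>v N \<and> (\<exists>l. C *\<^sub>v x = l \<cdot>\<^sub>v x)"
proof -
  have wN: "w \<in> carrier_vec N" using W w by (auto simp: lin_closed_def)
  have "\<exists>x\<in>W. x \<noteq> 0\<^sub>v N \<and> (\<exists>l. C *\<^sub>v x = l \<cdot>\<^sub>v x)"
    if "q \<noteq> 0" "degree q < m" "krylov_comb C w m q = 0\<^sub>v N" for m q
    using that
  proof (induction m arbitrary: q)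
    case 0
    then show ?case by simp
  next
    case (Suc m)
    show ?case
    proof (cases "degree q = 0")
      case True
      then obtain a where q: "q = [:a:]" by (rule degree_eq_zeroE)
      have "a \<noteq> 0" using Suc.prems q by simp
      have "krylov_comb C w (Suc m) q = a \<cdot>\<^sub>v w"
        unfolding krylov_comb_def q using wN by (intro eq_vecI) (auto simp: sum.lessThan_Suc_shift simp del: sum.lessThan_Suc)
      then have "a \<cdot>\<^sub>v w = 0\<^sub>v N" using Suc.prems by simp
      then have "inverse a \<cdot>\<^sub>v (a \<cdot>\<^sub>v w) = inverse a \<cdot>\<^sub>v 0\<^sub>v N" by simp
      moreover have "inverse a \<cdot>\<^sub>v 0\<^sub>v N = (0\<^sub>v N :: complex vec)" by (intro eq_vecI) auto
      ultimately have "w = 0\<^sub>v N" using \<open>a \<noteq> 0\<close> by (simp add: smult_smult_assoc)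
      with w show ?thesis by simp
    next
      case False
      then have "\<not> constant (poly q)" by (simp add: constant_degree)
      then obtain l where "poly q l = 0" using fundamental_theorem_of_algebra by blast
      then obtain q' where q: "q = [:- l, 1:] * q'" unfolding poly_eq_0_iff_dvd by (rule dvdE)
      have q0: "q' \<noteq> 0" using q Suc.prems(1) by auto
      have "degree q = Suc (degree q')"
        unfolding q using q0 by (subst degree_mult_eq) auto
      then have deg: "degree q' < m" using Suc.prems(2) by simp
      let ?x = "krylov_comb C w m q'"
      have x: "?x \<in> W" by (rule krylov_comb_in[OF W w(1) inv])
      then have xN: "?x \<in> carrier_vec N" using W by (auto simp: lin_closed_def)
      have z: "C *\<^sub>v ?x - l \<cdot>\<^sub>v ?x = 0\<^sub>v N"
        using krylov_comb_shift[OF C wN deg, of l] Suc.prems(3) q by simp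
      show ?thesis
      proof (cases "?x = 0\<^sub>v N")
        case True
        then show ?thesis using Suc.IH[OF q0 deg] by simp
      next
        case False
        have "C *\<^sub>v ?x = l \<cdot>\<^sub>v ?x"
        proof (rule eq_vecI)
          fix i assume "i < dim_vec (l \<cdot>\<^sub>v ?x)"
          then have i: "i < N" using xN by simp
          have "(C *\<^sub>v ?x - l \<cdot>\<^sub>v ?x) $ i = 0" using z i by simp
          then show "(C *\<^sub>v ?x) $ i = (l \<cdot>\<^sub>v ?x) $ i" using i C xN by simp
        qed (use C xN in simp)
        with False x show ?thesis by blast
      qed
    qed
  qed
  moreover obtain q where "q \<noteq> 0" "degree q \<le> N" "krylov_comb C w (Suc N) q = 0\<^sub>v N"
    using krylov_comb_annihilator[OF wN] by blast
  ultimately show ?thesis by (metis le_imp_less_Suc)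
qed

text \<open>By commutation \<open>S\<close> preserves each eigenspace of \<open>C\<close> inside
  \<open>W\<close>, so the previous lemma applies once more, within such an eigenspace.\<close>

lemma joint_eigenvector_in_invariant_subspace:
  assumes C: "C \<in> carrier_mat N N" and S: "S \<in> carrier_mat N N" and CS: "C * S = S * C"
    and W: "lin_closed N W"
    and inv: "\<And>u. u \<in> W \<Longrightarrow> C *\<^sub>v u \<in> W" "\<And>u. u \<in> W \<Longrightarrow> S *\<^sub>v u \<in> W"
    and w: "w \<in> W" "w \<noteq> 0\<^sub>v N"
  shows "\<exists>x\<in>W. x \<noteq> 0\<^sub>v N \<and> (\<exists>l. C *\<^sub>v x = l \<cdot>\<^sub>v x) \<and> (\<exists>s. S *\<^sub>v x = s \<cdot>\<^sub>v x)"
proof -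
  obtain y l where y: "y \<in> W" "y \<noteq> 0\<^sub>v N" "C *\<^sub>v y = l \<cdot>\<^sub>v y"
    using eigenvector_in_invariant_subspace[OF C W inv(1) w] by blast
  let ?W = "{x \<in> W. C *\<^sub>v x = l \<cdot>\<^sub>v x}"
  have WN: "x \<in> carrier_vec N" if "x \<in> W" for x using that W by (auto simp: lin_closed_def)
  have "lin_closed N ?W"
    using W WN C unfolding lin_closed_def
    by (auto simp: mult_add_distrib_mat_vec[of _ N N] mult_mat_vec[of _ N N] smult_add_distrib_vec[of _ N]
        smult_smult_assoc mult.commute)
  moreover have "S *\<^sub>v x \<in> ?W" if x: "x \<in> ?W" for x
  proof -
    have xN: "x \<in> carrier_vec N" using x WN by auto
    have "C *\<^sub>v (S *\<^sub>v x) = (C * S) *\<^sub>v x" using C S xN by simp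
    also have "\<dots> = S *\<^sub>v (C *\<^sub>v x)" unfolding CS using C S xN by simp
    also have "\<dots> = l \<cdot>\<^sub>v (S *\<^sub>v x)" using x S xN by (simp add: mult_mat_vec)
    finally show ?thesis using x inv by simp
  qed
  ultimately obtain x s where "x \<in> ?W" "x \<noteq> 0\<^sub>v N" "S *\<^sub>v x = s \<cdot>\<^sub>v x"
    using eigenvector_in_invariant_subspace[OF S, of ?W y] y by blast
  then show ?thesis by blast
qed

section \<open>Diagonalisation by congruence\<close>

text \<open>The new vector is sought in the complement of the \<open>x i\<close> for the form of
  \<open>M\<close>, which is nonzero because it is cut out by \<open>k < N\<close> conditions. The
  eigenvector equations of the \<open>x i\<close> make this complement invariant under
  \<open>M^-H M\<close> and \<open>S\<close>. The form is not Hermitian, so the complement gives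
  orthogonality on one side only; the other side follows from the equation satisfied by
  \<open>y\<close>.\<close>

lemma sectorial_family_extend:
  fixes M S :: "complex mat" and x :: "nat \<Rightarrow> complex vec"
  assumes M: "M \<in> carrier_mat N N" and S: "S \<in> carrier_mat N N"
    and nz: "\<And>x. x \<in> carrier_vec N \<Longrightarrow> x \<noteq> 0\<^sub>v N \<Longrightarrow> (M *\<^sub>v x) \<bullet>c x \<noteq> 0"
    and U: "mat_adjoint S * S = 1\<^sub>m N" and MS: "M * S = S * M" and k: "k < N"
    and x: "\<And>i. i < k \<Longrightarrow> x i \<in> carrier_vec N"
    and xS: "\<And>i. i < k \<Longrightarrow> S *\<^sub>v x i = s i \<cdot>\<^sub>v x i"
    and xM: "\<And>i. i < k \<Longrightarrow> M *\<^sub>v x i = c i \<cdot>\<^sub>v (mat_adjoint M *\<^sub>v x i)"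
    and x0: "\<And>i. i < k \<Longrightarrow> x i \<noteq> 0\<^sub>v N"
  shows "\<exists>y\<in>carrier_vec N. y \<noteq> 0\<^sub>v N \<and> (\<exists>t. S *\<^sub>v y = t \<cdot>\<^sub>v y) \<and>
    (\<exists>d. M *\<^sub>v y = d \<cdot>\<^sub>v (mat_adjoint M *\<^sub>v y)) \<and>
    (\<forall>i<k. (M *\<^sub>v y) \<bullet>c x i = 0 \<and> (M *\<^sub>v x i) \<bullet>c y = 0)"
proof -
  let ?MH = "mat_adjoint M" and ?SH = "mat_adjoint S"
  have MH: "?MH \<in> carrier_mat N N" and SH: "?SH \<in> carrier_mat N N"
    by (rule mat_adjoint_carrier[OF M], rule mat_adjoint_carrier[OF S])
  have MH0: "u = 0\<^sub>v N" if u: "u \<in> carrier_vec N" "?MH *\<^sub>v u = 0\<^sub>v N" for u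
  proof (rule ccontr)
    assume "u \<noteq> 0\<^sub>v N"
    moreover have "(M *\<^sub>v u) \<bullet>c u = 0" using cscalar_adjoint[OF M u(1) u(1)] u by simp
    ultimately show False using nz u by blast
  qed
  then obtain B where B: "B \<in> carrier_mat N N" "?MH * B = 1\<^sub>m N" "B * ?MH = 1\<^sub>m N"
    using det_nonzero_obtain_inverse[OF MH] by blast
  have S_SH: "S * ?SH = 1\<^sub>m N" by (rule mat_mult_left_right_inverse[OF SH S U])
  \<comment> \<open>The adjoint of \<open>M S = S M\<close> concerns \<open>S^H\<close>; multiplying
    by the unitary \<open>S\<close> from both sides turns it into commutation of \<open>M^H\<close>
    with \<open>S\<close>. Sandwiching by \<open>B\<close> then passes this on to the
    inverse.\<close>
  have "?SH * ?MH = ?MH * ?SH"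
    using MS mat_adjoint_mult[OF M S] mat_adjoint_mult[OF S M] by simp
  then have "S * (?SH * ?MH) * S = S * (?MH * ?SH) * S" by simp
  moreover have "S * (?SH * ?MH) * S = (S * ?SH) * ?MH * S"
    using S MH SH by (simp add: assoc_mult_mat[of _ N N _ N _ N])
  moreover have "S * (?MH * ?SH) * S = S * ?MH * (?SH * S)"
    using S MH SH by (simp add: assoc_mult_mat[of _ N N _ N _ N])
  ultimately have MHS: "?MH * S = S * ?MH" using S MH S_SH U by simp
  have "B * S = B * S * (?MH * B)" using B S by simp
  also have "\<dots> = B * (S * ?MH) * B"
    using S MH B(1) by (simp add: assoc_mult_mat[of _ N N _ N _ N])
  also have "\<dots> = (B * ?MH) * S * B"
    unfolding MHS[symmetric] using S MH B(1) by (simp add: assoc_mult_mat[of _ N N _ N _ N])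
  also have "\<dots> = S * B" using B S by simp
  finally have BS: "B * S = S * B" .
  \<comment> \<open>\<open>B\<close> is the inverse of \<open>M^H\<close>, so
    \<open>C y = d y\<close> is equivalent to \<open>M y = d M^H y\<close>.\<close>
  let ?C = "B * M"
  have C: "?C \<in> carrier_mat N N" using B M by simp
  have "?C * S = B * (M * S)" using B M S by (simp add: assoc_mult_mat[of _ N N _ N _ N])
  also have "\<dots> = (B * S) * M" unfolding MS using B M S by (simp add: assoc_mult_mat[of _ N N _ N _ N])
  also have "\<dots> = S * ?C" unfolding BS using B M S by (simp add: assoc_mult_mat[of _ N N _ N _ N])
  finally have CS: "?C * S = S * ?C" .
  have MHC: "?MH *\<^sub>v (?C *\<^sub>v u) = M *\<^sub>v u" if "u \<in> carrier_vec N" for u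
  proof -
    have "?MH *\<^sub>v (?C *\<^sub>v u) = (?MH * B) *\<^sub>v (M *\<^sub>v u)"
      using that B(1) M MH by simp
    then show ?thesis using that B(2) M by simp
  qed
  have c0: "c i \<noteq> 0" if i: "i < k" for i
  proof
    assume "c i = 0"
    then have "M *\<^sub>v x i = 0\<^sub>v N" using xM[OF i] MH x[OF i] by (auto intro!: eq_vecI)
    then have "(M *\<^sub>v x i) \<bullet>c x i = 0" using x[OF i] by simp
    with nz[OF x[OF i] x0[OF i]] show False by simp
  qed
  have MHx: "?MH *\<^sub>v x i = inverse (c i) \<cdot>\<^sub>v (M *\<^sub>v x i)" if i: "i < k" for i
    unfolding xM[OF i] using c0[OF i] by (simp add: smult_smult_assoc)
  have s0: "s i \<noteq> 0" and SHx: "?SH *\<^sub>v x i = inverse (s i) \<cdot>\<^sub>v x i" if i: "i < k" for i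
  proof -
    have "x i = (?SH * S) *\<^sub>v x i" using U x[OF i] by simp
    also have "\<dots> = ?SH *\<^sub>v (S *\<^sub>v x i)" using S SH x[OF i] by simp
    also have "\<dots> = s i \<cdot>\<^sub>v (?SH *\<^sub>v x i)" unfolding xS[OF i] by (rule mult_mat_vec[OF SH x[OF i]])
    finally have e: "x i = s i \<cdot>\<^sub>v (?SH *\<^sub>v x i)" .
    show s: "s i \<noteq> 0"
    proof
      assume "s i = 0"
      then have "s i \<cdot>\<^sub>v (?SH *\<^sub>v x i) = 0\<^sub>v N" using SH x[OF i] by (auto intro!: eq_vecI)
      with e x0[OF i] show False by metis
    qed
    from arg_cong[OF e, of "\<lambda>v. inverse (s i) \<cdot>\<^sub>v v"]
    have "inverse (s i) \<cdot>\<^sub>v x i = (inverse (s i) * s i) \<cdot>\<^sub>v (?SH *\<^sub>v x i)" by (simp only: smult_smult_assoc)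
    then show "?SH *\<^sub>v x i = inverse (s i) \<cdot>\<^sub>v x i" using s by simp
  qed
  let ?W = "{y \<in> carrier_vec N. \<forall>i<k. (M *\<^sub>v y) \<bullet>c x i = 0}"
  have W: "lin_closed N ?W"
    using M x unfolding lin_closed_def
    by (auto simp: mult_add_distrib_mat_vec[of _ N N] mult_mat_vec[of _ N N] add_scalar_prod_distrib[of _ N]
        smult_scalar_prod_distrib[of _ N])
  \<comment> \<open>Moving \<open>M\<close> to the other side yields \<open>M^H x i\<close>, a
    multiple of \<open>M x i\<close>; moving it back yields \<open>M^H C y = M y\<close>, which is
    orthogonal to \<open>x i\<close>.\<close>
  have WC: "?C *\<^sub>v y \<in> ?W" if y: "y \<in> ?W" for y
  proof -
    have yN: "y \<in> carrier_vec N" and Cy: "?C *\<^sub>v y \<in> carrier_vec N" using y C by auto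
    have "(M *\<^sub>v (?C *\<^sub>v y)) \<bullet>c x i = 0" if i: "i < k" for i
    proof -
      have "(M *\<^sub>v (?C *\<^sub>v y)) \<bullet>c x i = (?C *\<^sub>v y) \<bullet>c (?MH *\<^sub>v x i)"
        by (rule cscalar_adjoint[OF M Cy x[OF i]])
      also have "\<dots> = cnj (inverse (c i)) * ((?C *\<^sub>v y) \<bullet>c (M *\<^sub>v x i))"
        unfolding MHx[OF i] using Cy M x[OF i] by (intro cscalar_smult_right) auto
      also have "(?C *\<^sub>v y) \<bullet>c (M *\<^sub>v x i) = (?MH *\<^sub>v (?C *\<^sub>v y)) \<bullet>c x i"
        using cscalar_adjoint[OF MH Cy x[OF i]] by (simp add: mat_adjoint_adjoint[OF M])
      also have "\<dots> = 0" unfolding MHC[OF yN] using y i by simp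
      finally show ?thesis by simp
    qed
    with Cy show ?thesis by simp
  qed
  have WS: "S *\<^sub>v y \<in> ?W" if y: "y \<in> ?W" for y
  proof -
    have yN: "y \<in> carrier_vec N" and My: "M *\<^sub>v y \<in> carrier_vec N" using y M by auto
    have "(M *\<^sub>v (S *\<^sub>v y)) \<bullet>c x i = 0" if i: "i < k" for i
    proof -
      have "M *\<^sub>v (S *\<^sub>v y) = (M * S) *\<^sub>v y" using M S yN by simp
      also have "\<dots> = S *\<^sub>v (M *\<^sub>v y)" unfolding MS using M S yN by simp
      finally have "(M *\<^sub>v (S *\<^sub>v y)) \<bullet>c x i = (S *\<^sub>v (M *\<^sub>v y)) \<bullet>c x i" by simp
      also have "\<dots> = (M *\<^sub>v y) \<bullet>c (?SH *\<^sub>v x i)"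
        by (rule cscalar_adjoint[OF S My x[OF i]])
      also have "\<dots> = cnj (inverse (s i)) * ((M *\<^sub>v y) \<bullet>c x i)"
        unfolding SHx[OF i] by (rule cscalar_smult_right[OF My x[OF i]])
      also have "\<dots> = 0" using y i by simp
      finally show ?thesis .
    qed
    with yN S show ?thesis by simp
  qed
  \<comment> \<open>The condition on \<open>w\<close> written as a bilinear one, hence the
    conjugate: \<open>common_kernel_vector\<close> uses the product without conjugation.\<close>
  let ?K = "(\<lambda>i. conjugate (?MH *\<^sub>v x i)) ` {..<k}"
  have "?K \<subseteq> carrier_vec N" using MH x by auto
  moreover have "card ?K < N" using card_image_le[of "{..<k}" "\<lambda>i. conjugate (?MH *\<^sub>v x i)"] k by simp
  ultimately obtain w where w: "w \<in> carrier_vec N" "w \<noteq> 0\<^sub>v N" "\<forall>v\<in>?K. v \<bullet> w = 0"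
    using common_kernel_vector[of ?K N] by blast
  have "(M *\<^sub>v w) \<bullet>c x i = 0" if i: "i < k" for i
  proof -
    have "(M *\<^sub>v w) \<bullet>c x i = w \<bullet>c (?MH *\<^sub>v x i)" by (rule cscalar_adjoint[OF M w(1) x[OF i]])
    also have "\<dots> = conjugate (?MH *\<^sub>v x i) \<bullet> w"
      using MH x[OF i] w(1) by (intro comm_scalar_prod[of _ N]) auto
    also have "\<dots> = 0" using w(3) i by auto
    finally show ?thesis .
  qed
  then have wW: "w \<in> ?W" using w by simp
  from joint_eigenvector_in_invariant_subspace[OF C S CS W WC WS wW w(2)]
  obtain y d t where y: "y \<in> ?W" "y \<noteq> 0\<^sub>v N" "?C *\<^sub>v y = d \<cdot>\<^sub>v y" "S *\<^sub>v y = t \<cdot>\<^sub>v y"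
    by blast
  have yN: "y \<in> carrier_vec N" using y by simp
  have My: "M *\<^sub>v y = d \<cdot>\<^sub>v (?MH *\<^sub>v y)"
    using MHC[OF yN] y(3) mult_mat_vec[OF MH yN, of d] by simp
  have d0: "d \<noteq> 0"
  proof
    assume "d = 0"
    then have "M *\<^sub>v y = 0\<^sub>v N" using My MH yN by (auto intro!: eq_vecI)
    then have "(M *\<^sub>v y) \<bullet>c y = 0" using yN by simp
    with nz[OF yN y(2)] show False by simp
  qed
  have MHy: "?MH *\<^sub>v y = inverse d \<cdot>\<^sub>v (M *\<^sub>v y)"
    unfolding My using d0 by (simp add: smult_smult_assoc)
  \<comment> \<open>The other-sided orthogonality: since \<open>M^H y\<close> is a multiple of
    \<open>M y\<close>, the two products vanish together.\<close>
  have "(M *\<^sub>v x i) \<bullet>c y = 0" if i: "i < k" for i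
  proof -
    have MyN: "M *\<^sub>v y \<in> carrier_vec N" using M yN by simp
    have "(M *\<^sub>v x i) \<bullet>c y = x i \<bullet>c (?MH *\<^sub>v y)" by (rule cscalar_adjoint[OF M x[OF i] yN])
    also have "\<dots> = cnj (inverse d) * (x i \<bullet>c (M *\<^sub>v y))"
      unfolding MHy by (rule cscalar_smult_right[OF x[OF i] MyN])
    also have "x i \<bullet>c (M *\<^sub>v y) = cnj ((M *\<^sub>v y) \<bullet>c x i)" by (rule cscalar_commute[OF x[OF i] MyN])
    also have "\<dots> = 0" using y i by simp
    finally show ?thesis by simp
  qed
  with y My yN show ?thesis by blast
qed


text \<open>Besides orthogonality the induction carries both eigenvector equations, because the
  extension step needs them for all earlier vectors. Form values are normalised to modulus 1 so that
  they can become the entries of a unitary diagonal matrix.\<close>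

lemma sectorial_family:
  fixes M S :: "complex mat"
  assumes M: "M \<in> carrier_mat N N" and S: "S \<in> carrier_mat N N"
    and pos: "\<forall>x\<in>carrier_vec N. x \<noteq> 0\<^sub>v N \<longrightarrow> (M *\<^sub>v x) \<bullet>c x \<noteq> 0"
    and U: "mat_adjoint S * S = 1\<^sub>m N" and MS: "M * S = S * M" and k: "k \<le> N"
  shows "\<exists>x s c. (\<forall>i<k. x i \<in> carrier_vec N \<and> x i \<noteq> 0\<^sub>v N \<and> S *\<^sub>v x i = s i \<cdot>\<^sub>v x i \<and>
      M *\<^sub>v x i = c i \<cdot>\<^sub>v (mat_adjoint M *\<^sub>v x i) \<and> cmod ((M *\<^sub>v x i) \<bullet>c x i) = 1) \<and>
    (\<forall>i<k. \<forall>j<k. i \<noteq> j \<longrightarrow> (M *\<^sub>v x j) \<bullet>c x i = 0)"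
  using k
proof (induction k)
  case 0
  then show ?case by simp
next
  case (Suc k)
  have nz: "(M *\<^sub>v x) \<bullet>c x \<noteq> 0" if "x \<in> carrier_vec N" "x \<noteq> 0\<^sub>v N" for x
    using pos that by blast
  from Suc.IH[OF Suc_leD[OF Suc.prems]] obtain x s c where
    x: "\<forall>i<k. x i \<in> carrier_vec N \<and> x i \<noteq> 0\<^sub>v N \<and> S *\<^sub>v x i = s i \<cdot>\<^sub>v x i \<and>
      M *\<^sub>v x i = c i \<cdot>\<^sub>v (mat_adjoint M *\<^sub>v x i) \<and> cmod ((M *\<^sub>v x i) \<bullet>c x i) = 1"
    and xo: "\<forall>i<k. \<forall>j<k. i \<noteq> j \<longrightarrow> (M *\<^sub>v x j) \<bullet>c x i = 0"
    by (elim exE conjE)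
  obtain y t d where y: "y \<in> carrier_vec N" "y \<noteq> 0\<^sub>v N" and yS: "S *\<^sub>v y = t \<cdot>\<^sub>v y"
    and yM: "M *\<^sub>v y = d \<cdot>\<^sub>v (mat_adjoint M *\<^sub>v y)"
    and yo: "\<forall>i<k. (M *\<^sub>v y) \<bullet>c x i = 0 \<and> (M *\<^sub>v x i) \<bullet>c y = 0"
    using sectorial_family_extend[OF M S nz U MS, of k x s c] x Suc.prems by auto
  define z where "z = (M *\<^sub>v y) \<bullet>c y"
  \<comment> \<open>Scaling \<open>y\<close> by a real \<open>a\<close> multiplies its form value
    \<open>z\<close> by \<open>a^2\<close>; this \<open>a\<close> makes the modulus 1 and leaves the
    argument unchanged.\<close>
  define a where "a = complex_of_real (1 / sqrt (cmod z))"
  have z0: "z \<noteq> 0" unfolding z_def by (rule nz[OF y])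
  have a0: "a \<noteq> 0" using z0 by (simp add: a_def)
  have ca: "cnj a = a" by (simp add: a_def)
  have MH: "mat_adjoint M \<in> carrier_mat N N" by (rule mat_adjoint_carrier[OF M])
  let ?y = "a \<cdot>\<^sub>v y"
  have yN: "?y \<in> carrier_vec N" using y by simp
  have y0: "?y \<noteq> 0\<^sub>v N"
  proof
    assume "?y = 0\<^sub>v N"
    then have "inverse a \<cdot>\<^sub>v ?y = inverse a \<cdot>\<^sub>v 0\<^sub>v N" by simp
    also have "\<dots> = 0\<^sub>v N" by (intro eq_vecI) auto
    finally show False using a0 y(2) by (simp add: smult_smult_assoc)
  qed
  have My: "M *\<^sub>v ?y = a \<cdot>\<^sub>v (M *\<^sub>v y)" by (rule mult_mat_vec[OF M y(1)])
  have MyN: "M *\<^sub>v y \<in> carrier_vec N" using M y by simp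
  have "(M *\<^sub>v ?y) \<bullet>c ?y = a * (a * z)"
    unfolding My z_def using y(1) MyN by (simp add: cscalar_smult_right[of _ N] ca smult_scalar_prod_distrib[of _ N])
  then have "cmod ((M *\<^sub>v ?y) \<bullet>c ?y) = (cmod a * cmod a) * cmod z" by (simp add: norm_mult)
  also have "\<dots> = 1" using z0 by (simp add: a_def norm_divide)
  finally have y1: "cmod ((M *\<^sub>v ?y) \<bullet>c ?y) = 1" .
  have yS': "S *\<^sub>v ?y = t \<cdot>\<^sub>v ?y"
    unfolding mult_mat_vec[OF S y(1)] yS by (simp add: smult_smult_assoc mult.commute)
  have yM': "M *\<^sub>v ?y = d \<cdot>\<^sub>v (mat_adjoint M *\<^sub>v ?y)"
    unfolding My mult_mat_vec[OF MH y(1)] arg_cong[OF yM, of "\<lambda>v. a \<cdot>\<^sub>v v"]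
    by (simp add: smult_smult_assoc mult.commute)
  have yo': "(M *\<^sub>v ?y) \<bullet>c x i = 0" "(M *\<^sub>v x i) \<bullet>c ?y = 0" if "i < k" for i
  proof -
    have xi: "x i \<in> carrier_vec N" using x that by blast
    show "(M *\<^sub>v ?y) \<bullet>c x i = 0"
      unfolding My using yo that xi MyN by (simp add: smult_scalar_prod_distrib[of _ N])
    show "(M *\<^sub>v x i) \<bullet>c ?y = 0"
      using yo that xi M y(1) by (simp add: cscalar_smult_right[of _ N])
  qed
  let ?x = "x(k := ?y)" and ?s = "s(k := t)" and ?c = "c(k := d)"
  show ?case
  proof (rule exI[of _ ?x], rule exI[of _ ?s], rule exI[of _ ?c], intro conjI)
    show "\<forall>i<Suc k. ?x i \<in> carrier_vec N \<and> ?x i \<noteq> 0\<^sub>v N \<and> S *\<^sub>v ?x i = ?s i \<cdot>\<^sub>v ?x i \<and>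
        M *\<^sub>v ?x i = ?c i \<cdot>\<^sub>v (mat_adjoint M *\<^sub>v ?x i) \<and> cmod ((M *\<^sub>v ?x i) \<bullet>c ?x i) = 1"
    proof (intro allI impI)
      fix i assume "i < Suc k"
      then consider "i < k" | "i = k" by linarith
      then show "?x i \<in> carrier_vec N \<and> ?x i \<noteq> 0\<^sub>v N \<and> S *\<^sub>v ?x i = ?s i \<cdot>\<^sub>v ?x i \<and>
        M *\<^sub>v ?x i = ?c i \<cdot>\<^sub>v (mat_adjoint M *\<^sub>v ?x i) \<and> cmod ((M *\<^sub>v ?x i) \<bullet>c ?x i) = 1"
      proof cases
        case 1
        then have "i \<noteq> k" by simp
        then show ?thesis unfolding fun_upd_other[OF \<open>i \<noteq> k\<close>] using x 1 by blast
      next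
        case 2
        show ?thesis unfolding 2 fun_upd_same using yN y0 yS' yM' y1 by blast
      qed
    qed
    show "\<forall>i<Suc k. \<forall>j<Suc k. i \<noteq> j \<longrightarrow> (M *\<^sub>v ?x j) \<bullet>c ?x i = 0"
      using yo' xo by (auto simp: less_Suc_eq)
  qed
qed

section \<open>Numerical range, congruence bases and quadratic forms\<close>

lemma zero_notin_numerical_range_iff:
  assumes M: "M \<in> carrier_mat N N"
  shows "0 \<notin> numerical_range M \<longleftrightarrow> (\<forall>x\<in>carrier_vec N. x \<noteq> 0\<^sub>v N \<longrightarrow> (M *\<^sub>v x) \<bullet>c x \<noteq> 0)"
proof
  assume 0: "0 \<notin> numerical_range M"
  show "\<forall>x\<in>carrier_vec N. x \<noteq> 0\<^sub>v N \<longrightarrow> (M *\<^sub>v x) \<bullet>c x \<noteq> 0"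
  proof (intro ballI impI notI)
    fix x assume x: "x \<in> carrier_vec N" "x \<noteq> 0\<^sub>v N" and z: "(M *\<^sub>v x) \<bullet>c x = 0"
    define q where "q = x \<bullet>c x"
    have q: "q > 0" unfolding q_def using x by simp
    then have qr: "q = complex_of_real (Re q)" "Re q > 0" by (auto simp: less_complex_def complex_eq_iff)
    define a where "a = complex_of_real (1 / sqrt (Re q))"
    have ca: "cnj a = a" by (simp add: a_def)
    have aa: "a * a * q = 1"
      using qr(2) by (subst qr(1)) (simp add: a_def flip: of_real_mult)
    have "(a \<cdot>\<^sub>v x) \<bullet>c (a \<cdot>\<^sub>v x) = a * a * q"
      using x(1) by (simp add: cscalar_smult_right[of _ N] ca q_def smult_scalar_prod_distrib[of _ N])
    moreover have "(M *\<^sub>v (a \<cdot>\<^sub>v x)) \<bullet>c (a \<cdot>\<^sub>v x) = 0"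
      using x(1) M z by (simp add: mult_mat_vec[of _ N N] cscalar_smult_right[of _ N] smult_scalar_prod_distrib[of _ N])
    ultimately have "0 \<in> numerical_range M"
      using x(1) M aa unfolding numerical_range_def
      by (intro CollectI exI[of _ "a \<cdot>\<^sub>v x"]) auto
    with 0 show False by simp
  qed
next
  assume *: "\<forall>x\<in>carrier_vec N. x \<noteq> 0\<^sub>v N \<longrightarrow> (M *\<^sub>v x) \<bullet>c x \<noteq> 0"
  show "0 \<notin> numerical_range M"
  proof
    assume "0 \<in> numerical_range M"
    then obtain x where x: "x \<in> carrier_vec N" "(M *\<^sub>v x) \<bullet>c x = 0" "x \<bullet>c x = 1"
      using M unfolding numerical_range_def by auto
    then have "x \<noteq> 0\<^sub>v N" by auto
    with * x show False by blast
  qed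
qed

text \<open>\<open>cong_basis M x d\<close>: the matrix \<open>X\<close> with columns \<open>x 0, x 1, \<dots>\<close> satisfies \<open>X\<^sup>H M X = diag(exp(\<i> d\<^sub>i))\<close>.\<close>

definition cong_basis :: "complex mat \<Rightarrow> (nat \<Rightarrow> complex vec) \<Rightarrow> real vec \<Rightarrow> bool" where
  "cong_basis M x d \<longleftrightarrow> (\<forall>i<dim_row M. x i \<in> carrier_vec (dim_row M)) \<and>
     (\<forall>i<dim_row M. \<forall>j<dim_row M. (M *\<^sub>v x j) \<bullet>c x i = (if i = j then cis (d $ i) else 0))"

definition col_mat :: "nat \<Rightarrow> (nat \<Rightarrow> complex vec) \<Rightarrow> complex mat" where
  "col_mat N x = mat N N (\<lambda>(i, j). x j $ i)"

lemma col_mat_carrier [simp]: "col_mat N x \<in> carrier_mat N N"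
  and col_mat_dim [simp]: "dim_row (col_mat N x) = N" "dim_col (col_mat N x) = N"
  and col_mat_index [simp]: "i < N \<Longrightarrow> j < N \<Longrightarrow> col_mat N x $$ (i, j) = x j $ i"
  by (simp_all add: col_mat_def)

lemma cong_basis_mult:
  assumes M: "M \<in> carrier_mat N N" and x: "\<And>i. i < N \<Longrightarrow> x i \<in> carrier_vec N" and ij: "i < N" "j < N"
  shows "(mat_adjoint (col_mat N x) * M * col_mat N x) $$ (i, j) = (M *\<^sub>v x j) \<bullet>c x i"
proof -
  let ?X = "col_mat N x"
  have XH: "mat_adjoint ?X \<in> carrier_mat N N" by (rule mat_adjoint_carrier) simp
  have c: "col ?X j = x j" using x[OF ij(2)] ij by (intro eq_vecI) (auto simp: col_mat_def)
  have "(mat_adjoint ?X * M * ?X) $$ (i, j) = (mat_adjoint ?X * (M * ?X)) $$ (i, j)"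
    using assoc_mult_mat[OF XH M col_mat_carrier] by simp
  also have "\<dots> = row (mat_adjoint ?X) i \<bullet> (M *\<^sub>v x j)"
    using XH M ij c by (subst index_mult_mat) (auto simp: col_mult2[OF M col_mat_carrier])
  also have "row (mat_adjoint ?X) i = conjugate (x i)"
    using XH x[OF ij(1)] ij by (intro eq_vecI) (auto simp: mat_adjoint_index[OF col_mat_carrier])
  also have "\<dots> \<bullet> (M *\<^sub>v x j) = (M *\<^sub>v x j) \<bullet>c x i"
    using M x ij by (intro comm_scalar_prod[of _ N]) auto
  finally show ?thesis .
qed

text \<open>Independence of the \<open>x i\<close> is not shown separately: as
  \<open>X^H M X = D\<close> is invertible, \<open>D^-1 X^H M\<close> is a left inverse of
  \<open>X\<close>. It serves as \<open>T\<close>, and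
  \<open>T^H D T = (X T)^H M (X T) = M\<close>.\<close>

lemma cong_basis_decomp:
  assumes M: "M \<in> carrier_mat N N" and d: "d \<in> carrier_vec N" and x: "cong_basis M x d"
  shows "\<exists>T. sectorial_decomp M T d \<and> T * col_mat N x = 1\<^sub>m N \<and> col_mat N x * T = 1\<^sub>m N"
proof -
  let ?X = "col_mat N x" and ?D = "mat_diag N (\<lambda>i. cis (d $ i))" and ?D' = "mat_diag N (\<lambda>i. cis (- d $ i))"
  have xN: "x i \<in> carrier_vec N" if "i < N" for i using x M that by (auto simp: cong_basis_def)
  have X: "?X \<in> carrier_mat N N" by simp
  have XH: "mat_adjoint ?X \<in> carrier_mat N N" by (rule mat_adjoint_carrier) simp
  have XMX: "mat_adjoint ?X * M * ?X = ?D"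
  proof (rule eq_matI)
    fix i j assume "i < dim_row ?D" "j < dim_col ?D"
    then have ij: "i < N" "j < N" by (auto simp: mat_diag_def)
    show "(mat_adjoint ?X * M * ?X) $$ (i, j) = ?D $$ (i, j)"
      using cong_basis_mult[OF M xN ij] x M ij by (simp add: cong_basis_def mat_diag_def)
  qed (use XH in \<open>auto simp: mat_diag_def\<close>)
  have D'D: "?D' * ?D = 1\<^sub>m N" by (simp add: cis_mult)
  define T where "T = ?D' * (mat_adjoint ?X * M)"
  have T: "T \<in> carrier_mat N N" using XH M by (auto simp: T_def intro!: mult_carrier_mat[of _ N N _ N])
  have "T * ?X = ?D' * (mat_adjoint ?X * M * ?X)"
    unfolding T_def using XH M by (intro assoc_mult_mat[of _ N N _ N _ N] mult_carrier_mat[of _ N N _ N]) auto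
  then have TX: "T * ?X = 1\<^sub>m N" using XMX D'D by simp
  have XT: "?X * T = 1\<^sub>m N" by (rule mat_mult_left_right_inverse[OF T X TX])
  have TH: "mat_adjoint T \<in> carrier_mat N N" by (rule mat_adjoint_carrier[OF T])
  have THXH: "mat_adjoint T * mat_adjoint ?X = 1\<^sub>m N"
    using mat_adjoint_mult[OF X T] XT mat_adjoint_one by simp
  have "mat_adjoint T * ?D * T = mat_adjoint T * (mat_adjoint ?X * M * ?X) * T" using XMX by simp
  also have "\<dots> = (mat_adjoint T * mat_adjoint ?X) * M * (?X * T)"
    using TH XH M X T by (simp add: assoc_mult_mat[of _ N N _ N _ N] mult_carrier_mat[of _ N N _ N])
  also have "\<dots> = M" using THXH XT M by simp
  finally have "M = mat_adjoint T * ?D * T" by simp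
  moreover have "invertible_mat T"
    using T TX XT X by (auto simp: invertible_mat_def inverts_mat_def)
  ultimately have "sectorial_decomp M T d"
    using M T d by (auto simp: sectorial_decomp_def Let_def)
  with TX XT show ?thesis by blast
qed

lemma sectorial_decomp_obtain_inverse:
  assumes "sectorial_decomp M T d" "M \<in> carrier_mat N N"
  obtains X where "T \<in> carrier_mat N N" "X \<in> carrier_mat N N" "T * X = 1\<^sub>m N" "X * T = 1\<^sub>m N"
    "d \<in> carrier_vec N" "M = mat_adjoint T * mat_diag N (\<lambda>i. cis (d $ i)) * T"
proof -
  have T: "T \<in> carrier_mat N N" and inv: "invertible_mat T" and rest: "d \<in> carrier_vec N"
    "M = mat_adjoint T * mat_diag N (\<lambda>i. cis (d $ i)) * T"
    using assms by (auto simp: sectorial_decomp_def Let_def)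
  from inv obtain X where X: "T * X = 1\<^sub>m N" "X * T = 1\<^sub>m (dim_row X)"
    using T by (auto simp: invertible_mat_def inverts_mat_def)
  have "dim_col X = N" using arg_cong[OF X(1), of dim_col] by simp
  moreover have "dim_row X = N" using arg_cong[OF X(2), of dim_col] T by simp
  ultimately show ?thesis using that[of X] T X rest by auto
qed

text \<open>Every form value is a combination of the unit numbers \<open>cis (d $ k)\<close> with
  nonnegative weights. All statements about phases below are read off from this cone.\<close>

lemma sectorial_decomp_quadratic_form:
  assumes dec: "sectorial_decomp M T d" and M: "M \<in> carrier_mat N N" and x: "x \<in> carrier_vec N"
  shows "(M *\<^sub>v x) \<bullet>c x = (\<Sum>k<N. cis (d $ k) * complex_of_real ((cmod ((T *\<^sub>v x) $ k))\<^sup>2))"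
proof -
  obtain X where T: "T \<in> carrier_mat N N" and Md: "M = mat_adjoint T * mat_diag N (\<lambda>i. cis (d $ i)) * T"
    using sectorial_decomp_obtain_inverse[OF dec M] by metis
  let ?D = "mat_diag N (\<lambda>i. cis (d $ i))"
  have TH: "mat_adjoint T \<in> carrier_mat N N" by (rule mat_adjoint_carrier[OF T])
  have Tx: "T *\<^sub>v x \<in> carrier_vec N" using T x by simp
  have "(M *\<^sub>v x) \<bullet>c x = (mat_adjoint T *\<^sub>v (?D *\<^sub>v (T *\<^sub>v x))) \<bullet>c x"
    unfolding Md using TH T x by (simp add: assoc_mult_mat_vec[of _ N N _ N])
  also have "\<dots> = (?D *\<^sub>v (T *\<^sub>v x)) \<bullet>c (mat_adjoint (mat_adjoint T) *\<^sub>v x)"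
    by (rule cscalar_adjoint[OF TH mult_mat_vec_carrier[OF mat_diag_dim Tx] x])
  also have "\<dots> = (?D *\<^sub>v (T *\<^sub>v x)) \<bullet>c (T *\<^sub>v x)" by (simp add: mat_adjoint_adjoint[OF T])
  also have "\<dots> = (\<Sum>k\<in>{0..<N}. (?D *\<^sub>v (T *\<^sub>v x)) $ k * cnj ((T *\<^sub>v x) $ k))"
    using Tx T by (simp add: scalar_prod_def)
  also have "\<dots> = (\<Sum>k\<in>{0..<N}. cis (d $ k) * complex_of_real ((cmod ((T *\<^sub>v x) $ k))\<^sup>2))"
  proof (rule sum.cong)
    fix k assume "k \<in> {0..<N}"
    then have k: "k < N" by simp
    have "(?D *\<^sub>v (T *\<^sub>v x)) $ k = (\<Sum>j\<in>{0..<N}. (if k = j then cis (d $ j) else 0) * (T *\<^sub>v x) $ j)"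
      using k Tx T unfolding mat_diag_def by (simp add: scalar_prod_def)
    also have "\<dots> = (\<Sum>j\<in>{0..<N}. if k = j then cis (d $ j) * (T *\<^sub>v x) $ j else 0)"
      by (intro sum.cong) auto
    also have "\<dots> = cis (d $ k) * (T *\<^sub>v x) $ k" using k by (subst sum.delta') auto
    finally show "(?D *\<^sub>v (T *\<^sub>v x)) $ k * cnj ((T *\<^sub>v x) $ k) =
        cis (d $ k) * complex_of_real ((cmod ((T *\<^sub>v x) $ k))\<^sup>2)"
      by (simp only: mult.assoc complex_norm_square)
  qed simp
  finally show ?thesis by (simp only: atLeast0LessThan)
qed

section \<open>Canonical arguments and existence of decompositions\<close>

lemma cis_Arg_unit:
  assumes "cmod z = 1"
  shows "cis (Arg z) = z"
proof -
  have "z \<noteq> 0" using assms by auto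
  then show ?thesis using assms by (simp add: cis_Arg sgn_eq)
qed

text \<open>If no nontrivial nonnegative combination vanishes, the points fit on an arc shorter than
  pi. After rotating \<open>z 0\<close> to 1, principal arguments already work: two of them at
  distance pi or more would, together with the point 1, produce a vanishing combination.\<close>

lemma cis_args_exist:
  fixes z :: "nat \<Rightarrow> complex"
  assumes N: "N > 0" and unit: "\<And>i. i < N \<Longrightarrow> cmod (z i) = 1"
    and nz: "\<And>t :: nat \<Rightarrow> real. (\<And>i. i < N \<Longrightarrow> t i \<ge> 0) \<Longrightarrow> (\<exists>i<N. t i > 0) \<Longrightarrow>
      (\<Sum>i<N. complex_of_real (t i) * z i) \<noteq> 0"
  shows "\<exists>\<theta>. (\<forall>i<N. z i = cis (\<theta> i)) \<and> (\<forall>i<N. \<forall>j<N. \<theta> i - \<theta> j < pi)"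
proof -
  define \<alpha> where "\<alpha> i = Arg (z i * cnj (z 0))" for i
  have z0: "z 0 * cnj (z 0) = 1" using complex_norm_square[of "z 0"] unit[OF N] by simp
  have cis_\<alpha>: "cis (\<alpha> i) = z i * cnj (z 0)" if "i < N" for i
  proof -
    have "cmod (z i * cnj (z 0)) = 1" using unit[OF that] unit[OF N] by (simp add: norm_mult)
    then show ?thesis unfolding \<alpha>_def by (rule cis_Arg_unit)
  qed
  have bnd: "- pi < \<alpha> i" "\<alpha> i \<le> pi" for i using Arg_bounded unfolding \<alpha>_def by auto
  have \<alpha>0: "\<alpha> 0 = 0" unfolding \<alpha>_def z0 by (rule cis_Arg_unique) auto
  have zi: "z i = z 0 * cis (\<alpha> i)" if "i < N" for i
    using cis_\<alpha>[OF that] z0 by (simp add: mult_ac)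
  \<comment> \<open>The indices \<open>0\<close>, \<open>i\<close> and \<open>j\<close> may
    coincide, so the weight function \<open>t\<close> adds up the contributions;
    \<open>ti > 0\<close> keeps the combination nontrivial.\<close>
  have comb: "\<not> (i < N \<and> j < N \<and> t0 \<ge> 0 \<and> ti \<ge> 0 \<and> tj \<ge> 0 \<and> ti > 0 \<and>
      complex_of_real t0 + complex_of_real ti * cis (\<alpha> i) + complex_of_real tj * cis (\<alpha> j) = 0)" for i j t0 ti tj
  proof
    assume *: "i < N \<and> j < N \<and> t0 \<ge> 0 \<and> ti \<ge> 0 \<and> tj \<ge> 0 \<and> ti > 0 \<and>
      complex_of_real t0 + complex_of_real ti * cis (\<alpha> i) + complex_of_real tj * cis (\<alpha> j) = 0"
    then have zij: "z i = z 0 * cis (\<alpha> i)" "z j = z 0 * cis (\<alpha> j)" using zi by blast+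
    define t where "t k = (if k = 0 then t0 else 0) + (if k = i then ti else 0) + (if k = j then tj else 0)" for k
    have "(\<Sum>k<N. complex_of_real (t k) * z k) =
      (\<Sum>k<N. (if k = 0 then complex_of_real t0 * z k else 0) + (if k = i then complex_of_real ti * z k else 0) +
        (if k = j then complex_of_real tj * z k else 0))"
      by (intro sum.cong) (auto simp: t_def algebra_simps)
    also have "\<dots> = complex_of_real t0 * z 0 + complex_of_real ti * z i + complex_of_real tj * z j"
      using * N by (simp add: sum.distrib)
    also have "\<dots> = z 0 * (complex_of_real t0 + complex_of_real ti * cis (\<alpha> i) + complex_of_real tj * cis (\<alpha> j))"
      unfolding zij by (simp add: algebra_simps)
    also have "\<dots> = 0" using * by simp
    finally have "(\<Sum>k<N. complex_of_real (t k) * z k) = 0" .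
    moreover have "t i > 0" "\<And>k. t k \<ge> 0" using * by (auto simp: t_def)
    ultimately show False using nz[of t] * by blast
  qed
  have spread: "\<alpha> i - \<alpha> j < pi" if ij: "i < N" "j < N" for i j
  proof (rule ccontr)
    assume "\<not> \<alpha> i - \<alpha> j < pi"
    then have ge: "\<alpha> i - \<alpha> j \<ge> pi" by simp
    show False
    proof (cases "\<alpha> i = pi")
      case True
      then show False using comb[of i j 1 1 0] ij by simp
    next
      case False
      let ?a = "\<alpha> i" and ?b = "\<alpha> j"
      have a: "0 < ?a" "?a < pi" and b: "- pi < ?b" "?b < 0" using ge False bnd[of i] bnd[of j] by auto
      have sa: "sin ?a > 0" using a by (simp add: sin_gt_zero)
      have sb: "sin (- ?b) > 0" using b by (intro sin_gt_zero) auto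
      have "sin (?a - ?b - pi) \<ge> 0" using ge a b by (intro sin_ge_zero) auto
      then have "- sin (?a - ?b) \<ge> 0" by (simp add: sin_diff cos_diff)
      \<comment> \<open>The linear relation between 1, \<open>cis ?a\<close> and
        \<open>cis ?b\<close>, whose coefficients are sines of the angle differences. They are
        nonnegative because \<open>?a - ?b\<close> lies between pi and
        \<open>2 * pi\<close>.\<close>
      moreover have "complex_of_real (- sin (?a - ?b)) + complex_of_real (sin (- ?b)) * cis ?a +
          complex_of_real (sin ?a) * cis ?b = 0"
        by (simp add: complex_eq_iff sin_diff algebra_simps)
      ultimately show False using comb[of i j "- sin (?a - ?b)" "sin (- ?b)" "sin ?a"] ij sa sb by linarith
    qed
  qed
  show ?thesis
  proof (intro exI[of _ "\<lambda>i. Arg (z 0) + \<alpha> i"] conjI allI impI)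
    fix i assume i: "i < N"
    have "cis (Arg (z 0)) = z 0" by (rule cis_Arg_unit[OF unit[OF N]])
    then show "z i = cis (Arg (z 0) + \<alpha> i)" unfolding zi[OF i] cis_mult[symmetric] by simp
  next
    fix i j assume "i < N" "j < N"
    then show "Arg (z 0) + \<alpha> i - (Arg (z 0) + \<alpha> j) < pi" using spread[of i j] by simp
  qed
qed

text \<open>Sorting gives the order, and subtracting one common multiple of \<open>2 * pi\<close>
  moves the midpoint of the extreme arguments into the prescribed interval without changing
  differences.\<close>

lemma canonical_args_exist:
  fixes \<theta> :: "nat \<Rightarrow> real"
  assumes N: "N > 0" and spread: "\<forall>i<N. \<forall>j<N. \<theta> i - \<theta> j < pi"
  shows "\<exists>\<rho> d. bij_betw \<rho> {..<N} {..<N} \<and> d \<in> carrier_vec N \<and> canonical_args d \<and> (\<forall>i<N. cis (d $ i) = cis (\<theta> (\<rho> i)))"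
proof -
  define xs where "xs = sort_key (\<lambda>i. - \<theta> i) [0..<N]"
  have len: "length xs = N" and set: "set xs = {..<N}" and dist: "distinct xs"
    and srt: "sorted (map (\<lambda>i. - \<theta> i) xs)" by (auto simp: xs_def)
  have lt: "xs ! i < N" if "i < N" for i using set len that nth_mem by blast
  have bij: "bij_betw (\<lambda>i. xs ! i) {..<N} {..<N}"
    using bij_betw_nth[OF dist] len set by simp
  have mono: "\<theta> (xs ! j) \<le> \<theta> (xs ! i)" if "i \<le> j" "j < N" for i j
    using sorted_nth_mono[OF srt that(1)] that len by simp
  define c where "c = (\<theta> (xs ! 0) + \<theta> (xs ! (N - 1))) / 2"
  \<comment> \<open>The least integer with \<open>c - 2 * pi * m \<le> pi\<close>; minimality gives
    the strict lower bound.\<close>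
  define m where "m = \<lceil>(c - pi) / (2 * pi)\<rceil>"
  define d where "d = vec N (\<lambda>i. \<theta> (xs ! i) - 2 * pi * of_int m)"
  have "(c - pi) / (2 * pi) \<le> of_int m" "of_int m < (c - pi) / (2 * pi) + 1"
    unfolding m_def by linarith+
  then have m: "c - 2 * pi * of_int m \<le> pi" "- pi < c - 2 * pi * of_int m"
    by (simp_all add: field_simps)
  have d: "d $ i = \<theta> (xs ! i) - 2 * pi * of_int m" if "i < N" for i using that by (simp add: d_def)
  have "canonical_args d"
    unfolding canonical_args_def Let_def
  proof (intro conjI allI impI)
    fix i j assume "i \<le> j" "j < dim_vec d"
    then show "d $ j \<le> d $ i" using mono by (simp add: d_def)
  next
    have dim: "dim_vec d = N" by (simp add: d_def)
    have c2: "(d $ 0 + d $ (N - 1)) / 2 = c - 2 * pi * of_int m" using N by (simp add: d c_def field_simps)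
    show "d $ 0 - d $ (dim_vec d - 1) < pi" unfolding dim using N spread lt[of 0] lt[of "N - 1"] by (simp add: d)
    show "- pi < (d $ 0 + d $ (dim_vec d - 1)) / 2" "(d $ 0 + d $ (dim_vec d - 1)) / 2 \<le> pi"
      unfolding dim c2 using m by auto
  qed
  moreover have "cis (d $ i) = cis (\<theta> (xs ! i))" if "i < N" for i
  proof -
    have "cis (2 * pi * of_int m) = 1" by (rule cis_multiple_2pi) simp
    then show ?thesis unfolding d[OF that] by (simp flip: cis_divide)
  qed
  moreover have "d \<in> carrier_vec N" by (simp add: d_def)
  ultimately show ?thesis using bij by (intro exI[of _ "\<lambda>i. xs ! i"] exI[of _ d]) auto
qed

text \<open>The columns of \<open>X = T^-1\<close> are eigenvectors of the unitary \<open>S\<close>,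
  so \<open>T S = E T\<close> and \<open>S T^H = T^H E\<close> with a diagonal \<open>E\<close>.
  Commutation of \<open>T^H H T\<close> with \<open>S\<close> thus reduces to commutation of the
  diagonal matrices \<open>H\<close> and \<open>E\<close>, whatever the entries of \<open>H\<close>
  are.\<close>

lemma sectorial_decomp_exists:
  fixes M S :: "complex mat"
  assumes N: "N > 0" and M: "M \<in> carrier_mat N N" and S: "S \<in> carrier_mat N N"
    and W: "0 \<notin> numerical_range M"
    and U: "mat_adjoint S * S = 1\<^sub>m N" and MS: "M * S = S * M"
  shows "\<exists>T d. canonical_args d \<and> sectorial_decomp M T d \<and>
    (\<forall>h. mat_adjoint T * mat_diag N h * T * S = S * (mat_adjoint T * mat_diag N h * T))"
proof -
  have nz: "(M *\<^sub>v x) \<bullet>c x \<noteq> 0" if "x \<in> carrier_vec N" "x \<noteq> 0\<^sub>v N" for x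
    using W that unfolding zero_notin_numerical_range_iff[OF M] by blast
  from sectorial_family[OF M S W[unfolded zero_notin_numerical_range_iff[OF M]] U MS order_refl] obtain x s c where
    x: "\<forall>i<N. x i \<in> carrier_vec N \<and> x i \<noteq> 0\<^sub>v N \<and> S *\<^sub>v x i = s i \<cdot>\<^sub>v x i \<and>
      M *\<^sub>v x i = c i \<cdot>\<^sub>v (mat_adjoint M *\<^sub>v x i) \<and> cmod ((M *\<^sub>v x i) \<bullet>c x i) = 1"
    and xo: "\<forall>i<N. \<forall>j<N. i \<noteq> j \<longrightarrow> (M *\<^sub>v x j) \<bullet>c x i = 0"
    by (elim exE conjE)
  define z where "z i = (M *\<^sub>v x i) \<bullet>c x i" for i
  have z1: "cmod (z i) = 1" if "i < N" for i unfolding z_def using x that by blast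
  have xN: "x i \<in> carrier_vec N" if "i < N" for i using x that by blast
  have xS: "S *\<^sub>v x i = s i \<cdot>\<^sub>v x i" if "i < N" for i using x that by blast
  have x0: "x i \<noteq> 0\<^sub>v N" if "i < N" for i using x that by blast
  have s1: "s i * cnj (s i) = 1" if "i < N" for i
  proof -
    have "(S *\<^sub>v x i) \<bullet>c (S *\<^sub>v x i) = x i \<bullet>c (mat_adjoint S *\<^sub>v (S *\<^sub>v x i))"
      by (rule cscalar_adjoint[OF S]) (use S xN[OF that] in auto)
    also have "mat_adjoint S *\<^sub>v (S *\<^sub>v x i) = (mat_adjoint S * S) *\<^sub>v x i"
      using S mat_adjoint_carrier[OF S] xN[OF that] by simp
    also have "\<dots> = x i" unfolding U using xN[OF that] by simp
    finally have "s i * cnj (s i) * (x i \<bullet>c x i) = x i \<bullet>c x i"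
      unfolding xS[OF that] using xN[OF that]
      by (simp add: cscalar_smult_right[of _ N] smult_scalar_prod_distrib[of _ N] mult_ac)
    moreover have "x i \<bullet>c x i \<noteq> 0" using xN[OF that] x0[OF that] by simp
    ultimately show ?thesis by simp
  qed
  have "\<exists>\<theta>. (\<forall>i<N. z i = cis (\<theta> i)) \<and> (\<forall>i<N. \<forall>j<N. \<theta> i - \<theta> j < pi)"
  proof (rule cis_args_exist[OF N z1])
    fix t :: "nat \<Rightarrow> real" assume t: "\<And>i. i < N \<Longrightarrow> t i \<ge> 0" and ex: "\<exists>i<N. t i > 0"
    \<comment> \<open>Arbitrary arguments suffice to obtain a \<open>T\<close> inverse to the basis
      matrix. At \<open>y = X v\<close> with entries \<open>sqrt (t i)\<close> in \<open>v\<close>,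
      the form takes the value \<open>\<Sum>k<N. t k * z k\<close>, which sectoriality keeps away
      from zero.\<close>
    define e where "e = vec N (\<lambda>i. Arg (z i))"
    have ez: "cis (e $ i) = z i" if "i < N" for i
      using that cis_Arg_unit[OF z1[OF that]] by (simp add: e_def)
    have "cong_basis M x e" using M xN xo ez by (auto simp: cong_basis_def z_def)
    from cong_basis_decomp[OF M _ this] obtain T where
      T: "sectorial_decomp M T e" "T * col_mat N x = 1\<^sub>m N" by (auto simp: e_def)
    have TN: "T \<in> carrier_mat N N" using T(1) M by (auto simp: sectorial_decomp_def Let_def)
    define v where "v = vec N (\<lambda>i. complex_of_real (sqrt (t i)))"
    define y where "y = col_mat N x *\<^sub>v v"
    have v: "v \<in> carrier_vec N" by (simp add: v_def)
    have y: "y \<in> carrier_vec N" unfolding y_def by (rule mult_mat_vec_carrier[OF col_mat_carrier v])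
    have "T *\<^sub>v y = (T * col_mat N x) *\<^sub>v v" unfolding y_def by (rule assoc_mult_mat_vec[OF TN col_mat_carrier v, symmetric])
    then have Ty: "T *\<^sub>v y = v" using T(2) v by simp
    have "y \<noteq> 0\<^sub>v N"
    proof
      assume "y = 0\<^sub>v N"
      then have "v = 0\<^sub>v N" using Ty TN by auto
      then have "v $ i = 0" if "i < N" for i using that by simp
      with ex show False by (auto simp: v_def)
    qed
    then have "(M *\<^sub>v y) \<bullet>c y \<noteq> 0" by (rule nz[OF y])
    also have "(M *\<^sub>v y) \<bullet>c y = (\<Sum>k<N. cis (e $ k) * complex_of_real ((cmod (v $ k))\<^sup>2))"
      using sectorial_decomp_quadratic_form[OF T(1) M y] Ty by simp
    also have "\<dots> = (\<Sum>k<N. complex_of_real (t k) * z k)"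
      using t ez by (intro sum.cong) (auto simp: v_def mult.commute)
    finally show "(\<Sum>k<N. complex_of_real (t k) * z k) \<noteq> 0" .
  qed
  then obtain \<theta> where th: "\<forall>i<N. z i = cis (\<theta> i)" "\<forall>i<N. \<forall>j<N. \<theta> i - \<theta> j < pi"
    by blast
  from canonical_args_exist[OF N th(2)] obtain \<rho> d where
    rho: "bij_betw \<rho> {..<N} {..<N}" and d: "d \<in> carrier_vec N" "canonical_args d"
      "\<forall>i<N. cis (d $ i) = cis (\<theta> (\<rho> i))" by blast
  have rN: "\<rho> i < N" if "i < N" for i using rho that by (auto simp: bij_betw_def)
  have rinj: "\<rho> i = \<rho> j \<longleftrightarrow> i = j" if "i < N" "j < N" for i j
    using rho that by (auto simp: bij_betw_def inj_on_def)
  let ?x = "\<lambda>i. x (\<rho> i)"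
  have "cis (d $ i) = (M *\<^sub>v x (\<rho> i)) \<bullet>c x (\<rho> i)" if "i < N" for i
    using d(3) th(1) rN[OF that] that by (simp only: z_def)
  then have "cong_basis M ?x d"
    using M xN xo rN rinj by (auto simp: cong_basis_def)
  from cong_basis_decomp[OF M d(1) this] obtain T where T: "sectorial_decomp M T d"
    "T * col_mat N ?x = 1\<^sub>m N" "col_mat N ?x * T = 1\<^sub>m N" by blast
  have TN: "T \<in> carrier_mat N N" using T(1) M by (auto simp: sectorial_decomp_def Let_def)
  let ?X = "col_mat N ?x" and ?E = "mat_diag N (\<lambda>i. s (\<rho> i))"
  have SX: "S * ?X = ?X * ?E"
  proof (rule eq_matI)
    fix i j assume "i < dim_row (?X * ?E)" "j < dim_col (?X * ?E)"
    then have ij: "i < N" "j < N" by (auto simp: mat_diag_def)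
    have c: "col ?X j = ?x j" using xN[OF rN[OF ij(2)]] ij by (intro eq_vecI) auto
    have "(S * ?X) $$ (i, j) = (S *\<^sub>v ?x j) $ i" using S ij c by simp
    also have "\<dots> = s (\<rho> j) * ?x j $ i" unfolding xS[OF rN[OF ij(2)]] using xN[OF rN[OF ij(2)]] ij by simp
    also have "\<dots> = (?X * ?E) $$ (i, j)"
      using ij by (subst mat_diag_mult_right[of _ N N]) (auto simp: mult.commute)
    finally show "(S * ?X) $$ (i, j) = (?X * ?E) $$ (i, j)" .
  qed (use S in \<open>auto simp: mat_diag_def\<close>)
  have X: "?X \<in> carrier_mat N N" and E: "?E \<in> carrier_mat N N" by auto
  note cs = TN X E S mult_carrier_mat[of _ N N _ N] assoc_mult_mat[of _ N N _ N _ N]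
  have "T * S = T * S * (?X * T)" using T(3) TN S by (simp add: mult_carrier_mat[of _ N N _ N])
  also have "\<dots> = T * (S * ?X) * T" by (simp add: cs)
  also have "\<dots> = (T * ?X) * ?E * T" unfolding SX by (simp add: cs)
  also have "\<dots> = ?E * T" unfolding T(2) left_mult_one_mat[OF E] ..
  finally have TS: "T * S = ?E * T" .
  let ?TH = "mat_adjoint T" and ?EH = "mat_adjoint ?E" and ?SH = "mat_adjoint S"
  have TH: "?TH \<in> carrier_mat N N" and EH: "?EH \<in> carrier_mat N N" and SH: "?SH \<in> carrier_mat N N"
    using TN E S by (auto intro: mat_adjoint_carrier)
  have "?EH * ?E = mat_diag N (\<lambda>i. cnj (s (\<rho> i)) * s (\<rho> i))" by (simp add: mat_adjoint_mat_diag)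
  also have "\<dots> = 1\<^sub>m N" using s1 rN by (intro eq_matI) (auto simp: mat_diag_def mult.commute)
  finally have EHE: "?EH * ?E = 1\<^sub>m N" .
  have SSH: "S * ?SH = 1\<^sub>m N" by (rule mat_mult_left_right_inverse[OF SH S U])
  have adj: "?SH * ?TH = ?TH * ?EH"
    using mat_adjoint_mult[OF TN S] mat_adjoint_mult[OF E TN] TS by simp
  \<comment> \<open>The adjoint of \<open>T S = E T\<close> involves \<open>S^H\<close> and
    \<open>E^H\<close>; unitarity of both moves them to the opposite sides.\<close>
  have "S * ?TH = S * (?TH * ?EH) * ?E"
    using EHE TH EH E S by (simp add: mult_carrier_mat[of _ N N _ N] assoc_mult_mat[of _ N N _ N _ N])
  also have "\<dots> = (S * ?SH) * ?TH * ?E"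
    unfolding adj[symmetric] using SH TH E S by (simp add: mult_carrier_mat[of _ N N _ N] assoc_mult_mat[of _ N N _ N _ N])
  also have "\<dots> = ?TH * ?E" unfolding SSH using TH by simp
  finally have STH: "S * ?TH = ?TH * ?E" .
  have "?TH * mat_diag N h * T * S = S * (?TH * mat_diag N h * T)" for h
  proof -
    let ?H = "mat_diag N h"
    have H: "?H \<in> carrier_mat N N" by simp
    note cs = mult_carrier_mat[of _ N N _ N] assoc_mult_mat[of _ N N _ N _ N]
    have "?TH * ?H * T * S = ?TH * ?H * (T * S)" using TH H TN S by (simp add: cs del: mat_diag_diag)
    also have "\<dots> = ?TH * (?H * ?E) * T" unfolding TS using TH H TN E by (simp add: cs del: mat_diag_diag)
    also have "?H * ?E = ?E * ?H" by (simp add: mult.commute)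
    also have "?TH * (?E * ?H) * T = (?TH * ?E) * ?H * T" using TH H TN E by (simp add: cs del: mat_diag_diag)
    also have "\<dots> = S * (?TH * ?H * T)" unfolding STH[symmetric] using TH H TN S by (simp add: cs del: mat_diag_diag)
    finally show ?thesis .
  qed
  with T(1) d(2) show ?thesis by blast
qed

section \<open>Interlacing and uniqueness of phases\<close>

lemma Im_rotated_cis_sum:
  "Im (cis (- c) * (\<Sum>k\<in>I. cis (d k) * complex_of_real (w k))) = (\<Sum>k\<in>I. sin (d k - c) * w k)"
proof -
  have "cis (- c) * (\<Sum>k\<in>I. cis (d k) * complex_of_real (w k)) =
      (\<Sum>k\<in>I. cis (d k - c) * complex_of_real (w k))"
    unfolding sum_distrib_left mult.assoc[symmetric] cis_mult by simp
  then show ?thesis by simp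
qed

lemma Re_rotated_cis_sum:
  "Re (cis (- c) * (\<Sum>k\<in>I. cis (d k) * complex_of_real (w k))) = (\<Sum>k\<in>I. cos (d k - c) * w k)"
proof -
  have "cis (- c) * (\<Sum>k\<in>I. cis (d k) * complex_of_real (w k)) =
      (\<Sum>k\<in>I. cis (d k - c) * complex_of_real (w k))"
    unfolding sum_distrib_left mult.assoc[symmetric] cis_mult by simp
  then show ?thesis by simp
qed

text \<open>A suitable \<open>x\<close> yields one number that is a combination of phases
  \<open>d $ k \<ge> d $ (i + r)\<close> and also of phases \<open>e $ k \<le> e $ i\<close>. If
  \<open>e $ i < d $ (i + r)\<close>, a line through the origin separates the two cones.
  \<open>G\<close>, \<open>R\<close> and \<open>K\<close> are general to cover two uses:
  \<open>G\<close> the matrix of \<open>E\<close> with \<open>K\<close> its nonzero phases, and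
  \<open>G\<close> the identity with \<open>K\<close> empty.\<close>

lemma phase_interlacing:
  fixes A B G R :: "complex mat"
  assumes A: "A \<in> carrier_mat N N" and B: "B \<in> carrier_mat N N"
    and dA: "sectorial_decomp A T d" and dB: "sectorial_decomp B U e"
    and G: "G \<in> carrier_mat N N" and R: "R \<in> carrier_mat N N"
    and K: "K \<subseteq> {..<N}" "card K \<le> r"
    and eq: "\<And>x. x \<in> carrier_vec N \<Longrightarrow> (\<And>k. k \<in> K \<Longrightarrow> (R *\<^sub>v x) $ k = 0) \<Longrightarrow>
      (A *\<^sub>v x) \<bullet>c x = (B *\<^sub>v (G *\<^sub>v x)) \<bullet>c (G *\<^sub>v x)"
    and md: "\<And>i j. i \<le> j \<Longrightarrow> j < N \<Longrightarrow> d $ j \<le> d $ i"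
    and me: "\<And>i j. i \<le> j \<Longrightarrow> j < N \<Longrightarrow> e $ j \<le> e $ i"
    and spread: "\<And>i j. i < N \<Longrightarrow> j < N \<Longrightarrow> d $ i - e $ j < pi"
    and ir: "i + r < N"
  shows "d $ (i + r) \<le> e $ i"
proof (rule ccontr)
  assume "\<not> d $ (i + r) \<le> e $ i"
  then have gt: "d $ (i + r) > e $ i" by simp
  obtain X where T: "T \<in> carrier_mat N N" and X: "X \<in> carrier_mat N N" "X * T = 1\<^sub>m N"
    using sectorial_decomp_obtain_inverse[OF dA A] by metis
  have U: "U \<in> carrier_mat N N" using dB B by (auto simp: sectorial_decomp_def Let_def)
  have UG: "U * G \<in> carrier_mat N N" using U G by simp
  \<comment> \<open>At most \<open>r\<close>, \<open>N - 1 - (i + r)\<close> and \<open>i\<close>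
    conditions, together at most \<open>N - 1\<close>.\<close>
  let ?K1 = "row R ` K" and ?K2 = "row T ` {i + r<..<N}" and ?K3 = "row (U * G) ` {..<i}"
  let ?K = "?K1 \<union> ?K2 \<union> ?K3"
  have finK: "finite K" using K(1) finite_subset by blast
  have fin: "finite ?K" using finK by simp
  have "card ?K1 \<le> r" using card_image_le[OF finK, of "row R"] K(2) by simp
  moreover have "card ?K2 \<le> N - Suc (i + r)" using card_image_le[of "{i + r<..<N}" "row T"] by simp
  moreover have "card ?K3 \<le> i" using card_image_le[of "{..<i}" "row (U * G)"] by simp
  moreover have "card ?K \<le> card ?K1 + card ?K2 + card ?K3"
    using card_Un_le[of "?K1 \<union> ?K2" ?K3] card_Un_le[of ?K1 ?K2] by linarith
  ultimately have card: "card ?K < N" using ir by linarith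
  have "?K1 \<subseteq> carrier_vec N" "?K2 \<subseteq> carrier_vec N" "?K3 \<subseteq> carrier_vec N"
    using R T G by (auto intro!: carrier_vecI)
  then have KN: "?K \<subseteq> carrier_vec N" by simp
  obtain x where x: "x \<in> carrier_vec N" "x \<noteq> 0\<^sub>v N" "\<forall>v\<in>?K. v \<bullet> x = 0"
    using common_kernel_vector[OF fin card KN] by blast
  have Rx: "(R *\<^sub>v x) $ k = 0" if "k \<in> K" for k
  proof -
    have "row R k \<bullet> x = 0" using x(3) that by blast
    then show ?thesis using R K(1) that by auto
  qed
  have Tx: "(T *\<^sub>v x) $ k = 0" if "i + r < k" "k < N" for k
  proof -
    have "row T k \<bullet> x = 0" using x(3) that by auto
    then show ?thesis using T that by auto
  qed
  have Ux: "(U *\<^sub>v (G *\<^sub>v x)) $ k = 0" if "k < i" for k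
  proof -
    have "row (U * G) k \<bullet> x = 0" using x(3) that by blast
    then have "((U * G) *\<^sub>v x) $ k = 0" using UG that ir by auto
    then show ?thesis using U G x(1) by simp
  qed
  have Gx: "G *\<^sub>v x \<in> carrier_vec N" using G x(1) by simp
  define w where "w k = (cmod ((T *\<^sub>v x) $ k))\<^sup>2" for k
  define v where "v k = (cmod ((U *\<^sub>v (G *\<^sub>v x)) $ k))\<^sup>2" for k
  have w0: "w k = 0" if "i + r < k" "k < N" for k using Tx that by (simp add: w_def)
  have v0: "v k = 0" if "k < i" for k using Ux that by (simp add: v_def)
  have "(\<Sum>k<N. cis (d $ k) * complex_of_real (w k)) = (\<Sum>k<N. cis (e $ k) * complex_of_real (v k))"
    using sectorial_decomp_quadratic_form[OF dA A x(1)] sectorial_decomp_quadratic_form[OF dB B Gx]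
      eq[OF x(1) Rx] unfolding w_def v_def by simp
  then have sums: "(\<Sum>k<N. sin (d $ k - c) * w k) = (\<Sum>k<N. sin (e $ k - c) * v k)" for c
    using Im_rotated_cis_sum[of c "\<lambda>k. d $ k" w "{..<N}"] Im_rotated_cis_sum[of c "\<lambda>k. e $ k" v "{..<N}"]
    by simp
  \<comment> \<open>Rotation by the midpoint \<open>-c\<close> puts the phases of \<open>A\<close>
    in use strictly above the real axis and those of \<open>B\<close> on or below it;
    \<open>spread\<close> keeps the angles from wrapping around.\<close>
  define c where "c = (d $ (i + r) + e $ i) / 2"
  have c: "e $ i < c" "c < d $ (i + r)" using gt by (simp_all add: c_def)
  have pos: "sin (d $ k - c) > 0" if "k \<le> i + r" for k
  proof (rule sin_gt_zero)
    show "0 < d $ k - c" using md[OF that ir] c by simp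
    show "d $ k - c < pi" using spread[of k i] that ir c by simp
  qed
  \<comment> \<open>A weak sign is enough on this side, so \<open>G x = 0\<close> does no harm;
    strictness comes from \<open>T x \<noteq> 0\<close>.\<close>
  have neg: "sin (e $ k - c) \<le> 0" if "i \<le> k" "k < N" for k
  proof -
    have "e $ k - c < 0" using me[OF that] c by simp
    moreover have "c - e $ k < pi" using spread[OF ir that(2)] c by simp
    ultimately have "sin (c - e $ k) \<ge> 0" by (intro sin_ge_zero) auto
    then show ?thesis using sin_minus[of "c - e $ k"] by simp
  qed
  have "(\<Sum>k<N. sin (e $ k - c) * v k) \<le> 0"
  proof (rule sum_nonpos)
    fix k assume "k \<in> {..<N}"
    then show "sin (e $ k - c) * v k \<le> 0"
      using neg[of k] v0[of k] by (cases "k < i") (auto simp: v_def intro!: mult_nonpos_nonneg)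
  qed
  moreover have "(\<Sum>k<N. sin (d $ k - c) * w k) > 0"
  proof -
    have "\<exists>k<N. w k \<noteq> 0"
    proof (rule ccontr)
      assume "\<not> (\<exists>k<N. w k \<noteq> 0)"
      then have "T *\<^sub>v x = 0\<^sub>v N" using T by (intro eq_vecI) (auto simp: w_def)
      moreover have "x = X *\<^sub>v (T *\<^sub>v x)"
        using assoc_mult_mat_vec[OF X(1) T x(1)] X(2) x(1) by simp
      ultimately show False using X(1) x(2) by auto
    qed
    then obtain k where k: "k < N" "w k \<noteq> 0" by blast
    show ?thesis
    proof (rule sum_pos2[OF _ _ _])
      show "k \<in> {..<N}" using k by simp
      have "k \<le> i + r" using w0[of k] k by (cases "k \<le> i + r") auto
      moreover have "w k > 0" using k by (simp add: w_def)
      ultimately show "0 < sin (d $ k - c) * w k" using pos by simp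
      fix l assume "l \<in> {..<N}"
      then show "0 \<le> sin (d $ l - c) * w l"
        using pos[of l] w0[of l] by (cases "l \<le> i + r") (auto simp: w_def)
    qed simp
  qed
  ultimately show False using sums by simp
qed

text \<open>The cone over an arc shorter than pi contains no directions outside that arc. Relative
  to the centre \<open>c\<close>, a positive cosine confines the argument \<open>t\<close> to the
  open right half-plane; there the signs of the sines at the two edges confine it to
  \<open>[-h, h]\<close>.\<close>

lemma cone_argument:
  fixes d w :: "nat \<Rightarrow> real"
  assumes d: "\<And>k. k < N \<Longrightarrow> a \<le> d k \<and> d k \<le> b" and ab: "b - a < pi" and w: "\<And>k. w k \<ge> 0"
    and z: "cis e = (\<Sum>k<N. cis (d k) * complex_of_real (w k))"
  shows "\<exists>\<theta> (m :: int). a \<le> \<theta> \<and> \<theta> \<le> b \<and> e = \<theta> + 2 * pi * of_int m"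
proof -
  define c where "c = (a + b) / 2"
  define h where "h = (b - a) / 2"
  have "\<exists>k<N. w k \<noteq> 0"
  proof (rule ccontr)
    assume "\<not> (\<exists>k<N. w k \<noteq> 0)"
    then have "cis e = 0" unfolding z by (intro sum.neutral) auto
    then show False by simp
  qed
  then obtain k where k: "k < N" "w k > 0" using w by (metis less_eq_real_def)
  have h: "0 \<le> h" "h < pi / 2" using d[OF k(1)] ab by (auto simp: h_def)
  define t where "t = Arg (cis (e - c))"
  have t: "- pi < t" "t \<le> pi" using Arg_bounded unfolding t_def by auto
  have ct: "cis t = cis (e - c)" unfolding t_def by (rule cis_Arg_unit) simp
  have cd: "cos (d k - c) > 0" if "k < N" for k
    using d[OF that] h by (intro cos_gt_zero_pi) (auto simp: c_def h_def field_simps)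
  have "cos (e - c) = (\<Sum>k<N. cos (d k - c) * w k)"
    using Re_rotated_cis_sum[of c d w "{..<N}"] unfolding z[symmetric] cis_mult by simp
  also have "\<dots> > 0"
    using k cd w by (intro sum_pos2[of _ k]) (auto simp: less_imp_le)
  finally have cpos: "cos t > 0" using ct by (simp add: complex_eq_iff)
  have tb: "\<bar>t\<bar> < pi / 2"
  proof (rule ccontr)
    assume "\<not> \<bar>t\<bar> < pi / 2"
    then have "cos \<bar>t\<bar> \<le> cos (pi / 2)" using t by (intro cos_monotone_0_pi_le) auto
    with cpos show False by simp
  qed
  have "sin (e - a) \<ge> 0"
  proof -
    have "sin (e - a) = (\<Sum>k<N. sin (d k - a) * w k)"
      using Im_rotated_cis_sum[of a d w "{..<N}"] unfolding z[symmetric] cis_mult by simp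
    also have "\<dots> \<ge> 0"
    proof (rule sum_nonneg)
      fix k assume "k \<in> {..<N}"
      then have "sin (d k - a) \<ge> 0" using d[of k] ab by (intro sin_ge_zero) auto
      then show "sin (d k - a) * w k \<ge> 0" using w by simp
    qed
    finally show ?thesis .
  qed
  moreover have "sin (e - a) = sin (t + h)"
  proof -
    have "cis (e - c) * cis h = cis t * cis h" using ct by simp
    moreover have "e - c + h = e - a" by (simp add: c_def h_def field_simps)
    ultimately show ?thesis by (simp add: cis_mult complex_eq_iff)
  qed
  ultimately have lo: "sin (t + h) \<ge> 0" by simp
  have "sin (e - b) \<le> 0"
  proof -
    have "sin (e - b) = (\<Sum>k<N. sin (d k - b) * w k)"
      using Im_rotated_cis_sum[of b d w "{..<N}"] unfolding z[symmetric] cis_mult by simp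
    also have "\<dots> \<le> 0"
    proof (rule sum_nonpos)
      fix k assume "k \<in> {..<N}"
      then have "sin (b - d k) \<ge> 0" using d[of k] ab by (intro sin_ge_zero) auto
      then have "sin (d k - b) \<le> 0" using sin_minus[of "b - d k"] by simp
      then show "sin (d k - b) * w k \<le> 0" using w by (simp add: mult_nonpos_nonneg)
    qed
    finally show ?thesis .
  qed
  moreover have "sin (e - b) = sin (t - h)"
  proof -
    have "cis (e - c) * cis (- h) = cis t * cis (- h)" using ct by simp
    moreover have "e - c - h = e - b" by (simp add: c_def h_def field_simps)
    ultimately show ?thesis by (simp add: cis_mult complex_eq_iff)
  qed
  ultimately have hi: "sin (t - h) \<le> 0" by simp
  have "t + h \<ge> 0"
  proof (rule ccontr)
    assume "\<not> t + h \<ge> 0"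
    then have "sin (- (t + h)) > 0" using tb h by (intro sin_gt_zero) auto
    with lo show False unfolding sin_minus by linarith
  qed
  moreover have "t - h \<le> 0"
  proof (rule ccontr)
    assume "\<not> t - h \<le> 0"
    then have "sin (t - h) > 0" using tb h by (intro sin_gt_zero) auto
    with hi show False by simp
  qed
  moreover obtain m :: int where "e - c = t + 2 * pi * of_int m"
    using ct sin_cos_eq_iff[of "e - c" t] by (auto simp: complex_eq_iff)
  ultimately show ?thesis
    by (intro exI[of _ "c + t"] exI[of _ m]) (auto simp: c_def h_def field_simps)
qed

lemma canonical_argsD:
  assumes "canonical_args d" "d \<in> carrier_vec N"
  shows "\<And>i j. i \<le> j \<Longrightarrow> j < N \<Longrightarrow> d $ j \<le> d $ i"
    and "d $ 0 - d $ (N - 1) < pi"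
    and "- pi < (d $ 0 + d $ (N - 1)) / 2" "(d $ 0 + d $ (N - 1)) / 2 \<le> pi"
  using assms by (auto simp: canonical_args_def Let_def)

text \<open>Interlacing can compare two phase vectors only on a common arc, which is not known
  beforehand. Taking \<open>x\<close> with \<open>U x\<close> a unit vector makes a single
  \<open>cis (e $ j)\<close> a form value, so \<open>cone_argument\<close> locates it among the
  \<open>d\<close> up to a multiple of \<open>2 * pi\<close>.\<close>

lemma phase_range_shift:
  fixes M :: "complex mat"
  assumes N: "N > 0" and M: "M \<in> carrier_mat N N"
    and dT: "sectorial_decomp M T d" "canonical_args d"
    and eU: "sectorial_decomp M U e" "canonical_args e"
  shows "\<exists>k :: int. d $ (N - 1) + 2 * pi * of_int k \<le> e $ (N - 1) \<and> e $ 0 \<le> d $ 0 + 2 * pi * of_int k"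
proof -
  have dN: "d \<in> carrier_vec N" and eN: "e \<in> carrier_vec N"
    using dT(1) eU(1) M by (auto simp: sectorial_decomp_def Let_def)
  note d = canonical_argsD[OF dT(2) dN] and e = canonical_argsD[OF eU(2) eN]
  obtain Y where U: "U \<in> carrier_mat N N" and Y: "Y \<in> carrier_mat N N" "U * Y = 1\<^sub>m N"
    using sectorial_decomp_obtain_inverse[OF eU(1) M] by metis
  have ex: "\<exists>\<theta> (m :: int). d $ (N - 1) \<le> \<theta> \<and> \<theta> \<le> d $ 0 \<and> e $ j = \<theta> + 2 * pi * of_int m" if j: "j < N" for j
  proof -
    let ?x = "Y *\<^sub>v unit_vec N j"
    have x: "?x \<in> carrier_vec N" using Y by simp
    have Ux: "U *\<^sub>v ?x = unit_vec N j"
      using assoc_mult_mat_vec[OF U Y(1) unit_vec_carrier] Y(2) by simp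
    have "(\<Sum>k<N. cis (e $ k) * complex_of_real ((cmod ((U *\<^sub>v ?x) $ k))\<^sup>2)) =
      (\<Sum>k<N. if k = j then cis (e $ k) else 0)"
      unfolding Ux using j by (intro sum.cong) auto
    also have "\<dots> = cis (e $ j)" using j by simp
    finally have "cis (e $ j) = (\<Sum>k<N. cis (d $ k) * complex_of_real ((cmod ((T *\<^sub>v ?x) $ k))\<^sup>2))"
      using sectorial_decomp_quadratic_form[OF dT(1) M x] sectorial_decomp_quadratic_form[OF eU(1) M x] by simp
    then show ?thesis
      by (rule cone_argument[rotated 3]) (use d N in auto)
  qed
  obtain t1 and m1 :: int where 1: "d $ (N - 1) \<le> t1" "t1 \<le> d $ 0" "e $ 0 = t1 + 2 * pi * of_int m1"
    using ex[OF N] by blast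
  obtain t2 and m2 :: int where 2: "d $ (N - 1) \<le> t2" "t2 \<le> d $ 0" "e $ (N - 1) = t2 + 2 * pi * of_int m2"
    using ex[of "N - 1"] N by auto
  have "e $ (N - 1) \<le> e $ 0" using e(1)[of 0 "N - 1"] N by simp
  \<comment> \<open>Both ends use the same multiple: the ends of \<open>e\<close>, and likewise
    \<open>t1\<close> and \<open>t2\<close>, differ by less than pi, so \<open>m1 - m2\<close> lies
    strictly between -1 and 1.\<close>
  then have lo: "2 * pi * (of_int m1 - of_int m2) > - pi" using 1 2 d(2) by (simp add: right_diff_distrib)
  have hi: "2 * pi * (of_int m1 - of_int m2) < 2 * pi" using 1 2 d(2) e(2) by (simp add: right_diff_distrib)
  have pi2: "2 * pi > 0" by simp
  have "2 * pi * (- 1) < 2 * pi * (of_int m1 - of_int m2)" using lo pi_gt_zero by linarith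
  then have "real_of_int (m1 - m2) > - 1" unfolding mult_less_cancel_left_pos[OF pi2] by simp
  moreover have "2 * pi * (of_int m1 - of_int m2) < 2 * pi * 1" using hi by linarith
  then have "real_of_int (m1 - m2) < 1" unfolding mult_less_cancel_left_pos[OF pi2] by simp
  ultimately have "m1 = m2" by linarith
  then show ?thesis using 1 2 by (intro exI[of _ m1]) auto
qed

text \<open>Range comparison in both directions shows equal extreme phases up to one shift, the
  midpoint condition excludes a nonzero shift, and interlacing with \<open>r = 0\<close> in both
  directions then settles the inner entries.\<close>

lemma canonical_phases_unique:
  fixes M :: "complex mat"
  assumes N: "N > 0" and M: "M \<in> carrier_mat N N"
    and dT: "sectorial_decomp M T d" "canonical_args d"
    and eU: "sectorial_decomp M U e" "canonical_args e"
  shows "d = e"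
proof -
  have dN: "d \<in> carrier_vec N" and eN: "e \<in> carrier_vec N"
    using dT(1) eU(1) M by (auto simp: sectorial_decomp_def Let_def)
  note d = canonical_argsD[OF dT(2) dN] and e = canonical_argsD[OF eU(2) eN]
  obtain k :: int where k: "d $ (N - 1) + 2 * pi * of_int k \<le> e $ (N - 1)" "e $ 0 \<le> d $ 0 + 2 * pi * of_int k"
    using phase_range_shift[OF N M dT eU] by blast
  obtain l :: int where l: "e $ (N - 1) + 2 * pi * of_int l \<le> d $ (N - 1)" "d $ 0 \<le> e $ 0 + 2 * pi * of_int l"
    using phase_range_shift[OF N M eU dT] by blast
  \<comment> \<open>Chaining the inequalities at the lower ends gives \<open>k + l \<le> 0\<close>,
    at the upper ends \<open>k + l \<ge> 0\<close>; hence all four are equalities.\<close>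
  have "2 * pi * of_int k + 2 * pi * of_int l = 0" using k l by linarith
  then have ends: "e $ (N - 1) = d $ (N - 1) + 2 * pi * of_int k" "e $ 0 = d $ 0 + 2 * pi * of_int k"
    using k l by linarith+
  have pi2: "2 * pi > 0" by simp
  define q where "q = 2 * pi * of_int k"
  have "q < 2 * pi" "- (2 * pi) < q"
    using d(3,4) e(3,4) unfolding ends q_def[symmetric] by (simp_all add: field_simps)
  then have "2 * pi * of_int k < 2 * pi * 1" "2 * pi * (- 1) < 2 * pi * of_int k"
    by (simp_all add: q_def)
  then have "real_of_int k < 1" "- 1 < real_of_int k"
    by (simp_all only: mult_less_cancel_left_pos[OF pi2])
  then have "k = 0" by linarith
  with ends have same: "e $ (N - 1) = d $ (N - 1)" "e $ 0 = d $ 0" by simp_all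
  have dl: "d $ (N - 1) \<le> d $ i" "d $ i \<le> d $ 0" and el: "e $ (N - 1) \<le> e $ i" "e $ i \<le> e $ 0"
    if "i < N" for i using d(1)[of i "N - 1"] d(1)[of 0 i] e(1)[of i "N - 1"] e(1)[of 0 i] that by auto
  have spread: "d $ i - e $ j < pi" "e $ i - d $ j < pi" if "i < N" "j < N" for i j
    using dl[OF that(1)] dl[OF that(2)] el[OF that(1)] el[OF that(2)] same d(2) by linarith+
  have one: "(1\<^sub>m N :: complex mat) \<in> carrier_mat N N" by simp
  show "d = e"
  proof (rule eq_vecI)
    fix i assume "i < dim_vec e"
    then have i: "i < N" using eN by simp
    have "d $ (i + 0) \<le> e $ i"
      by (rule phase_interlacing[OF M M dT(1) eU(1) one one, of "{}"])
        (use i d(1) e(1) spread M in auto)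
    moreover have "e $ (i + 0) \<le> d $ i"
      by (rule phase_interlacing[OF M M eU(1) dT(1) one one, of "{}"])
        (use i d(1) e(1) spread M in auto)
    ultimately show "d $ i = e $ i" by simp
  qed (use dN eN in simp)
qed

text \<open>Rotating by the midpoint of the extreme phases places the whole cone in the open right
  half-plane.\<close>

lemma sectorial_decomp_imp_sectorial:
  fixes M :: "complex mat"
  assumes M: "M \<in> carrier_mat N N" and dT: "sectorial_decomp M T d" "canonical_args d"
  shows "0 \<notin> numerical_range M"
  unfolding zero_notin_numerical_range_iff[OF M]
proof (intro ballI impI)
  fix x :: "complex vec" assume x: "x \<in> carrier_vec N" "x \<noteq> 0\<^sub>v N"
  have dN: "d \<in> carrier_vec N" using dT(1) M by (auto simp: sectorial_decomp_def Let_def)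
  note d = canonical_argsD[OF dT(2) dN]
  obtain X where T: "T \<in> carrier_mat N N" and X: "X \<in> carrier_mat N N" "X * T = 1\<^sub>m N"
    using sectorial_decomp_obtain_inverse[OF dT(1) M] by metis
  define w where "w k = (cmod ((T *\<^sub>v x) $ k))\<^sup>2" for k
  define c where "c = (d $ 0 + d $ (N - 1)) / 2"
  have "\<exists>k<N. w k \<noteq> 0"
  proof (rule ccontr)
    assume "\<not> (\<exists>k<N. w k \<noteq> 0)"
    then have "T *\<^sub>v x = 0\<^sub>v N" using T by (intro eq_vecI) (auto simp: w_def)
    moreover have "x = X *\<^sub>v (T *\<^sub>v x)"
      using assoc_mult_mat_vec[OF X(1) T x(1)] X(2) x(1) by simp
    ultimately show False using X(1) x(2) by auto
  qed
  then obtain k where k: "k < N" "w k \<noteq> 0" by blast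
  have pos: "cos (d $ k - c) > 0" if "k < N" for k
  proof -
    have "d $ k \<le> d $ 0" "d $ (N - 1) \<le> d $ k" using that by (auto intro!: d(1))
    then show ?thesis using d(2) by (intro cos_gt_zero_pi) (auto simp: c_def field_simps)
  qed
  have "Re (cis (- c) * ((M *\<^sub>v x) \<bullet>c x)) = (\<Sum>k<N. cos (d $ k - c) * w k)"
    unfolding sectorial_decomp_quadratic_form[OF dT(1) M x(1)] w_def by (rule Re_rotated_cis_sum)
  also have "\<dots> > 0"
    using k pos by (intro sum_pos2[of _ k]) (auto simp: w_def less_imp_le)
  finally show "(M *\<^sub>v x) \<bullet>c x \<noteq> 0" by auto
qed

section \<open>Block-circulant matrices\<close>

definition block_shift :: "nat \<Rightarrow> nat \<Rightarrow> nat \<Rightarrow> nat" where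
  "block_shift n p j = (j + n) mod (n * p)"

text \<open>The Kronecker product of the cyclic \<open>p x p\<close> permutation matrix with the
  identity of size \<open>n\<close>.\<close>

definition shift_mat :: "nat \<Rightarrow> nat \<Rightarrow> complex mat" where
  "shift_mat n p = mat (n * p) (n * p) (\<lambda>(i, j). if i = block_shift n p j then 1 else 0)"

lemma shift_mat_carrier: "shift_mat n p \<in> carrier_mat (n * p) (n * p)"
  by (simp add: shift_mat_def)

lemma block_shift_div_mod:
  assumes "n > 0"
  shows "block_shift n p j div n = (j div n + 1) mod p" "block_shift n p j mod n = j mod n"
  using assms by (simp_all add: block_shift_def mod_mult2_eq)

lemma block_shift_less: "n > 0 \<Longrightarrow> p > 0 \<Longrightarrow> block_shift n p j < n * p"
  by (simp add: block_shift_def)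

lemma Suc_mod_inj:
  assumes "a < p" "b < p" "(a + 1) mod p = (b + 1) mod p"
  shows "a = (b :: nat)"
  using assms by (cases "a + 1 = p"; cases "b + 1 = p") (auto simp: mod_less)

lemma block_shift_inj:
  assumes n: "n > 0" and ij: "i < n * p" "j < n * p" and eq: "block_shift n p i = block_shift n p j"
  shows "i = j"
proof -
  have "i div n < p" "j div n < p" using ij n by (simp_all add: less_mult_imp_div_less mult.commute)
  moreover have "(i div n + 1) mod p = (j div n + 1) mod p"
    using block_shift_div_mod(1)[OF n, of p i] block_shift_div_mod(1)[OF n, of p j] eq by simp
  ultimately have "i div n = j div n" by (rule Suc_mod_inj)
  moreover have "i mod n = j mod n"
    using block_shift_div_mod(2)[OF n, of p i] block_shift_div_mod(2)[OF n, of p j] eq by simp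
  ultimately show ?thesis by (metis div_mult_mod_eq)
qed

lemma mult_shift_mat:
  assumes n: "n > 0" and p: "p > 0" and M: "M \<in> carrier_mat (n * p) (n * p)" and ij: "i < n * p" "j < n * p"
  shows "(M * shift_mat n p) $$ (i, j) = M $$ (i, block_shift n p j)"
proof -
  have "(M * shift_mat n p) $$ (i, j) =
      (\<Sum>k\<in>{0..<n * p}. if k = block_shift n p j then M $$ (i, k) else 0)"
    using M ij by (simp add: shift_mat_def scalar_prod_def if_distrib cong: if_cong)
  also have "\<dots> = M $$ (i, block_shift n p j)" using block_shift_less[OF n p] by simp
  finally show ?thesis .
qed

lemma shift_mat_mult:
  assumes n: "n > 0" and p: "p > 0" and M: "M \<in> carrier_mat (n * p) (n * p)" and ij: "i < n * p" "j < n * p"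
  shows "(shift_mat n p * M) $$ (block_shift n p i, j) = M $$ (i, j)"
proof -
  have "(shift_mat n p * M) $$ (block_shift n p i, j) =
      (\<Sum>k\<in>{0..<n * p}. (if block_shift n p i = block_shift n p k then 1 else 0) * M $$ (k, j))"
    using M ij block_shift_less[OF n p] by (simp add: shift_mat_def scalar_prod_def)
  also have "\<dots> = (\<Sum>k\<in>{0..<n * p}. if k = i then M $$ (k, j) else 0)"
  proof (rule sum.cong)
    fix k assume "k \<in> {0..<n * p}"
    then have "block_shift n p i = block_shift n p k \<longleftrightarrow> k = i" using block_shift_inj[OF n ij(1), of k] by auto
    then show "(if block_shift n p i = block_shift n p k then 1 else 0) * M $$ (k, j) =
        (if k = i then M $$ (k, j) else 0)" by simp
  qed simp
  also have "\<dots> = M $$ (i, j)" using ij by simp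
  finally show ?thesis .
qed

lemma block_shift_surj:
  assumes n: "n > 0" and p: "p > 0" and i: "i < n * p"
  obtains k where "k < n * p" "block_shift n p k = i" "k div n = (i div n + p - 1) mod p" "k mod n = i mod n"
proof -
  let ?k = "((i div n + p - 1) mod p) * n + i mod n"
  have a: "i div n < p" using i n by (simp add: less_mult_imp_div_less mult.commute)
  have kd: "?k div n = (i div n + p - 1) mod p" "?k mod n = i mod n" using n by simp_all
  have "?k < n * p" using block_index_less[of "(i div n + p - 1) mod p" p "i mod n" n] n p by simp
  moreover have "block_shift n p ?k = i"
  proof -
    have "((i div n + p - 1) mod p + 1) mod p = i div n"
      using a p by (subst mod_add_left_eq) simp
    then have "block_shift n p ?k div n = i div n" "block_shift n p ?k mod n = i mod n"
      using block_shift_div_mod[OF n, of p ?k] kd by simp_all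
    then show ?thesis by (metis div_mult_mod_eq)
  qed
  ultimately show ?thesis using that kd by blast
qed

lemma commute_shift_iff:
  assumes n: "n > 0" and p: "p > 0" and M: "M \<in> carrier_mat (n * p) (n * p)"
  shows "M * shift_mat n p = shift_mat n p * M \<longleftrightarrow>
    (\<forall>i<n * p. \<forall>j<n * p. M $$ (block_shift n p i, block_shift n p j) = M $$ (i, j))"
proof
  assume eq: "M * shift_mat n p = shift_mat n p * M"
  show "\<forall>i<n * p. \<forall>j<n * p. M $$ (block_shift n p i, block_shift n p j) = M $$ (i, j)"
    using mult_shift_mat[OF n p M block_shift_less[OF n p]] shift_mat_mult[OF n p M] unfolding eq by metis
next
  assume *: "\<forall>i<n * p. \<forall>j<n * p. M $$ (block_shift n p i, block_shift n p j) = M $$ (i, j)"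
  show "M * shift_mat n p = shift_mat n p * M"
  proof (rule eq_matI)
    fix i j assume "i < dim_row (shift_mat n p * M)" "j < dim_col (shift_mat n p * M)"
    then have ij: "i < n * p" "j < n * p" using M by (auto simp: shift_mat_def)
    obtain k where k: "k < n * p" "block_shift n p k = i" using block_shift_surj[OF n p ij(1)] by metis
    show "(M * shift_mat n p) $$ (i, j) = (shift_mat n p * M) $$ (i, j)"
      using mult_shift_mat[OF n p M ij] shift_mat_mult[OF n p M k(1) ij(2)] k * ij by auto
  qed (use M in \<open>auto simp: shift_mat_def\<close>)
qed

lemma bcirc_index:
  assumes A: "A \<in> tensors n n p" and p: "p > 0" and ij: "i < n * p" "j < n * p"
  shows "bcirc A $$ (i, j) = (A ! ((i div n + p - j div n) mod p)) $$ (i mod n, j mod n)"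
  using ij by (simp add: bcirc_def Let_def tensors_dims[OF A p])

lemma bcirc_carrier:
  assumes A: "A \<in> tensors n n p" and p: "p > 0"
  shows "bcirc A \<in> carrier_mat (n * p) (n * p)"
  by (simp add: bcirc_def Let_def tensors_dims[OF A p])

lemma Suc_mod_diff:
  assumes "a < p" "b < (p :: nat)"
  shows "((a + 1) mod p + p - (b + 1) mod p) mod p = (a + p - b) mod p"
  using assms by (cases "a + 1 = p"; cases "b + 1 = p") (auto simp: mod_less mod_if)

lemma bcirc_commutes_shift:
  assumes A: "A \<in> tensors n n p" and n: "n > 0" and p: "p > 0"
  shows "bcirc A * shift_mat n p = shift_mat n p * bcirc A"
  unfolding commute_shift_iff[OF n p bcirc_carrier[OF A p]]
proof (intro allI impI)
  fix i j assume ij: "i < n * p" "j < n * p"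
  then have "i div n < p" "j div n < p" using n by (simp_all add: less_mult_imp_div_less mult.commute)
  then show "bcirc A $$ (block_shift n p i, block_shift n p j) = bcirc A $$ (i, j)"
    using bcirc_index[OF A p ij] bcirc_index[OF A p block_shift_less[OF n p] block_shift_less[OF n p], of i j]
      Suc_mod_diff[of "i div n" p "j div n"]
    by (simp add: block_shift_div_mod[OF n])
qed

lemma pred_mod_diff:
  assumes "a < p" "b + 1 < (p :: nat)"
  shows "((a + p - 1) mod p + p - b) mod p = (a + p - (b + 1)) mod p"
proof (cases "a = 0")
  case True
  then have "(a + p - 1) mod p = p - 1" using assms by simp
  moreover have "p - 1 + p - b = (p - (b + 1)) + p" using assms by simp
  ultimately show ?thesis using True by simp
next
  case False
  then obtain c where a: "a = Suc c" by (cases a) auto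
  then have "(a + p - 1) mod p = c" using assms by simp
  then show ?thesis using a by simp
qed

text \<open>Stepping back along the block diagonal \<open>b\<close> times brings block column
  \<open>b\<close> to block column 0; the row block decreases by \<open>b\<close> modulo
  \<open>p\<close>, with \<open>p\<close> added to keep the natural subtraction exact.\<close>

lemma shift_invariant_first_block:
  assumes n: "n > 0" and p: "p > 0"
    and M: "\<forall>i<n * p. \<forall>j<n * p. M $$ (block_shift n p i, block_shift n p j) = M $$ (i, j)"
    and i: "i < n * p" and j: "j < n" and b: "b < p"
  shows "M $$ (i, b * n + j) = M $$ (((i div n + p - b) mod p) * n + i mod n, j)"
  using i b
proof (induction b arbitrary: i)
  case 0
  then have "i div n < p" using n by (simp add: less_mult_imp_div_less mult.commute)
  then show ?case by simp
next
  case (Suc b)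
  have a: "i div n < p" using Suc.prems n by (simp add: less_mult_imp_div_less mult.commute)
  obtain k where k: "k < n * p" "block_shift n p k = i" "k div n = (i div n + p - 1) mod p" "k mod n = i mod n"
    using block_shift_surj[OF n p Suc.prems(1)] by blast
  have bj: "b * n + j < n * p" using block_index_less[of b p j n] Suc.prems j by simp
  have "Suc b * n + j < n * p" using block_index_less[of "Suc b" p j n] Suc.prems j by simp
  then have "block_shift n p (b * n + j) = Suc b * n + j" by (simp add: block_shift_def ac_simps)
  then have "M $$ (i, Suc b * n + j) = M $$ (k, b * n + j)" using M k bj by metis
  also have "\<dots> = M $$ (((k div n + p - b) mod p) * n + k mod n, j)"
    using Suc.IH[OF k(1)] Suc.prems by simp
  also have "(k div n + p - b) mod p = (i div n + p - Suc b) mod p"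
    using pred_mod_diff[OF a, of b] Suc.prems k(3) by simp
  finally show ?case using k(4) by simp
qed

text \<open>The slices are read off the first block column, and invariance under the shift
  determines all other blocks from it.\<close>

lemma commutes_shift_imp_bcirc:
  assumes n: "n > 0" and p: "p > 0" and M: "M \<in> carrier_mat (n * p) (n * p)"
    and comm: "M * shift_mat n p = shift_mat n p * M"
  shows "M \<in> bcirc ` tensors n n p"
proof -
  have inv: "\<forall>i<n * p. \<forall>j<n * p. M $$ (block_shift n p i, block_shift n p j) = M $$ (i, j)"
    using comm commute_shift_iff[OF n p M] by simp
  define A where "A = map (\<lambda>k. mat n n (\<lambda>(i, j). M $$ (k * n + i, j))) [0..<p]"
  have A: "A \<in> tensors n n p" by (auto simp: A_def tensors_def)
  have "bcirc A = M"
  proof (rule eq_matI)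
    fix i j assume "i < dim_row M" "j < dim_col M"
    then have ij: "i < n * p" "j < n * p" using M by auto
    then have b: "j div n < p" using n by (simp add: less_mult_imp_div_less mult.commute)
    let ?k = "(i div n + p - j div n) mod p"
    have "?k < p" using p by simp
    then have "bcirc A $$ (i, j) = M $$ (?k * n + i mod n, j mod n)"
      unfolding bcirc_index[OF A p ij] using n by (simp add: A_def)
    also have "\<dots> = M $$ (i, j div n * n + j mod n)"
      using shift_invariant_first_block[OF n p inv ij(1) _ b, of "j mod n"] n by simp
    finally show "bcirc A $$ (i, j) = M $$ (i, j)" by simp
  qed (use M bcirc_carrier[OF A p] in auto)
  then show ?thesis using A by blast
qed

lemma shift_mat_unitary:
  assumes n: "n > 0" and p: "p > 0"
  shows "mat_adjoint (shift_mat n p) * shift_mat n p = 1\<^sub>m (n * p)"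
proof (rule eq_matI)
  let ?S = "shift_mat n p"
  have SH: "mat_adjoint ?S \<in> carrier_mat (n * p) (n * p)"
    by (auto simp: mat_adjoint_def shift_mat_def)
  fix i j assume "i < dim_row (1\<^sub>m (n * p) :: complex mat)" "j < dim_col (1\<^sub>m (n * p) :: complex mat)"
  then have ij: "i < n * p" "j < n * p" by auto
  have "(mat_adjoint ?S * ?S) $$ (i, j) = mat_adjoint ?S $$ (i, block_shift n p j)"
    by (rule mult_shift_mat[OF n p SH ij])
  also have "\<dots> = (if block_shift n p j = block_shift n p i then 1 else 0)"
    using ij block_shift_less[OF n p] by (simp add: mat_adjoint_def mat_of_rows_index shift_mat_def)
  also have "\<dots> = 1\<^sub>m (n * p) $$ (i, j)"
    using ij block_shift_inj[OF n ij] by auto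
  finally show "(mat_adjoint ?S * ?S) $$ (i, j) = 1\<^sub>m (n * p) $$ (i, j)" .
qed (auto simp: mat_adjoint_def shift_mat_def)

section \<open>T-product, identity and T-inverse under \<open>bcirc\<close>\<close>

lemma commutes_mult:
  fixes A B C :: "'a::semiring_1 mat"
  assumes "A \<in> carrier_mat N N" "B \<in> carrier_mat N N" "C \<in> carrier_mat N N" "A * C = C * A" "B * C = C * B"
  shows "A * B * C = C * (A * B)"
proof -
  have "A * B * C = A * (B * C)" using assms(1-3) by (intro assoc_mult_mat)
  also have "\<dots> = A * C * B" unfolding assms(5) using assms(1-3) by (intro assoc_mult_mat[symmetric])
  also have "\<dots> = C * (A * B)" unfolding assms(4) using assms(1-3) by (intro assoc_mult_mat)
  finally show ?thesis .
qed

text \<open>The product of the two matrices commutes with the shift, hence is \<open>bcirc C\<close>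
  for some \<open>C\<close>. Since \<open>t_unfold\<close> is the first block column,
  \<open>bcirc A * t_unfold B\<close> is that of \<open>bcirc C\<close>, so no sum over slices has
  to be evaluated.\<close>

lemma bcirc_t_prod:
  assumes A: "A \<in> tensors n n p" and B: "B \<in> tensors n n p" and n: "n > 0" and p: "p > 0"
  shows "A *\<^sub>T B \<in> tensors n n p" "bcirc (A *\<^sub>T B) = bcirc A * bcirc B"
proof -
  have cA: "bcirc A \<in> carrier_mat (n * p) (n * p)" and cB: "bcirc B \<in> carrier_mat (n * p) (n * p)"
    using bcirc_carrier A B p by auto
  have "bcirc A * bcirc B \<in> bcirc ` tensors n n p"
    using cA cB commutes_mult[OF cA cB shift_mat_carrier] bcirc_commutes_shift[OF A n p] bcirc_commutes_shift[OF B n p]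
    by (intro commutes_shift_imp_bcirc[OF n p]) auto
  then obtain C where C: "C \<in> tensors n n p" "bcirc A * bcirc B = bcirc C" by auto
  note dA = tensors_dims[OF A p] and dB = tensors_dims[OF B p] and dC = tensors_dims[OF C(1) p]
  have unf: "t_unfold D = mat (n * p) n (\<lambda>(i, j). bcirc D $$ (i, j))" if D: "D \<in> tensors n n p" for D
  proof (rule eq_matI)
    note dD = tensors_dims[OF D p]
    fix i j assume "i < dim_row (mat (n * p) n (\<lambda>(i, j). bcirc D $$ (i, j)))"
      "j < dim_col (mat (n * p) n (\<lambda>(i, j). bcirc D $$ (i, j)))"
    then have ij: "i < n * p" "j < n" by auto
    have jN: "j < n * p" using ij(2) p block_index_less[of 0 p j n] by simp
    have "i div n < p" using ij n by (simp add: less_mult_imp_div_less mult.commute)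
    then show "t_unfold D $$ (i, j) = mat (n * p) n (\<lambda>(i, j). bcirc D $$ (i, j)) $$ (i, j)"
      using ij bcirc_index[OF D p ij(1) jN] by (simp add: t_unfold_def Let_def dD)
  qed (simp_all add: t_unfold_def Let_def tensors_dims[OF D p])
  have "bcirc A * t_unfold B = t_unfold C"
    unfolding unf[OF B] unf[OF C(1)] C(2)[symmetric]
  proof (rule eq_matI, goal_cases)
    case (1 i j)
    then have ij: "i < n * p" "j < n" by auto
    have jN: "j < n * p" using ij(2) p block_index_less[of 0 p j n] by simp
    show ?case using cA cB ij jN by (simp add: scalar_prod_def)
  qed (use cA in auto)
  then have "A *\<^sub>T B = C" unfolding t_prod_def using t_fold_unfold[OF C(1) p] dA by simp
  then show "A *\<^sub>T B \<in> tensors n n p" "bcirc (A *\<^sub>T B) = bcirc A * bcirc B" using C by auto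
qed

lemma mod_diff_eq_0_iff:
  assumes "a < p" "b < (p :: nat)"
  shows "(a + p - b) mod p = 0 \<longleftrightarrow> a = b"
proof (cases "a < b")
  case True
  then have "a + p - b < p" "a + p - b > 0" using assms by linarith+
  then show ?thesis using True by simp
next
  case False
  then obtain c where "a = b + c" using le_Suc_ex by (metis not_less)
  then show ?thesis using assms by simp
qed

lemma bcirc_t_id:
  assumes n: "n > 0" and p: "p > 0"
  shows "t_id n p \<in> tensors n n p" "bcirc (t_id n p) = 1\<^sub>m (n * p)"
proof -
  show I: "t_id n p \<in> tensors n n p" using p by (auto simp: t_id_def tensors_def)
  show "bcirc (t_id n p) = 1\<^sub>m (n * p)"
  proof (rule eq_matI)
    fix i j assume "i < dim_row (1\<^sub>m (n * p) :: complex mat)" "j < dim_col (1\<^sub>m (n * p) :: complex mat)"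
    then have ij: "i < n * p" "j < n * p" by auto
    then have d: "i div n < p" "j div n < p" using n by (simp_all add: less_mult_imp_div_less mult.commute)
    let ?k = "(i div n + p - j div n) mod p"
    have k: "?k = 0 \<longleftrightarrow> i div n = j div n" by (rule mod_diff_eq_0_iff[OF d])
    have "?k < p" using p by simp
    then have "(t_id n p ! ?k) $$ (i mod n, j mod n) = (if ?k = 0 then 1\<^sub>m n else 0\<^sub>m n n) $$ (i mod n, j mod n)"
      by (auto simp: t_id_def nth_Cons split: nat.splits)
    also have "\<dots> = (if i div n = j div n \<and> i mod n = j mod n then 1 else 0)"
      using k n by simp
    also have "(i div n = j div n \<and> i mod n = j mod n) \<longleftrightarrow> i = j" by (metis div_mult_mod_eq)
    finally show "bcirc (t_id n p) $$ (i, j) = 1\<^sub>m (n * p) $$ (i, j)"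
      unfolding bcirc_index[OF I p ij] using ij by simp
  qed (use bcirc_carrier[OF I p] in auto)
qed

text \<open>The inverse of a matrix commuting with the shift commutes with it too, so it comes from
  a tensor. Together with uniqueness this evaluates the description in \<open>t_inv\<close>.\<close>

lemma t_inv_eqI:
  assumes E: "E \<in> tensors n n p" and n: "n > 0" and p: "p > 0"
    and Y: "Y \<in> carrier_mat (n * p) (n * p)" and EY: "bcirc E * Y = 1\<^sub>m (n * p)"
  shows "t_invertible E" "t_inv E \<in> tensors n n p" "bcirc (t_inv E) = Y"
proof -
  let ?S = "shift_mat n p" and ?N = "n * p"
  have cE: "bcirc E \<in> carrier_mat ?N ?N" by (rule bcirc_carrier[OF E p])
  have S: "?S \<in> carrier_mat ?N ?N" by (rule shift_mat_carrier)
  have YE: "Y * bcirc E = 1\<^sub>m ?N" by (rule mat_mult_left_right_inverse[OF cE Y EY])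
  note cs = mult_carrier_mat[of _ ?N ?N _ ?N] assoc_mult_mat[of _ ?N ?N _ ?N _ ?N]
  have "Y * ?S = Y * ?S * (bcirc E * Y)" unfolding EY using Y S by (simp add: cs)
  also have "\<dots> = Y * (?S * bcirc E) * Y" using Y S cE by (simp add: cs)
  also have "\<dots> = (Y * bcirc E) * ?S * Y"
    unfolding bcirc_commutes_shift[OF E n p, symmetric] using Y S cE by (simp add: cs)
  also have "\<dots> = ?S * Y" unfolding YE using Y S by simp
  finally obtain X where X: "X \<in> tensors n n p" "Y = bcirc X"
    using commutes_shift_imp_bcirc[OF n p Y] by auto
  note inj = bcirc_inj_on[OF p n, of n]
  note I = bcirc_t_id[OF n p]
  have EX: "E *\<^sub>T X = t_id n p"
    using inj_onD[OF inj] bcirc_t_prod[OF E X(1) n p] I EY X(2) by simp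
  have XE: "X *\<^sub>T E = t_id n p"
    using inj_onD[OF inj] bcirc_t_prod[OF X(1) E n p] I YE X(2) by simp
  have inv: "is_t_inverse E X"
    using X(1) EX XE by (simp add: is_t_inverse_def Let_def tensors_dims[OF E p])
  have uniq: "Z = X" if "is_t_inverse E Z" for Z
  proof -
    have Z: "Z \<in> tensors n n p" "E *\<^sub>T Z = t_id n p"
      using that by (auto simp: is_t_inverse_def Let_def tensors_dims[OF E p])
    have cZ: "bcirc Z \<in> carrier_mat ?N ?N" by (rule bcirc_carrier[OF Z(1) p])
    have EZ: "bcirc E * bcirc Z = 1\<^sub>m ?N" using bcirc_t_prod(2)[OF E Z(1) n p] Z(2) I(2) by simp
    have "bcirc Z = (Y * bcirc E) * bcirc Z" unfolding YE using cZ by simp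
    also have "\<dots> = Y" using assoc_mult_mat[OF Y cE cZ] EZ Y by simp
    finally show ?thesis using inj_onD[OF inj _ Z(1) X(1)] X(2) by simp
  qed
  show "t_invertible E" using inv by (auto simp: t_invertible_def)
  have "t_inv E = X" unfolding t_inv_def using inv uniq by (rule the_equality)
  then show "t_inv E \<in> tensors n n p" "bcirc (t_inv E) = Y" using X by auto
qed

section \<open>Monotonicity of symmetric gauge functions\<close>

text \<open>With \<open>t = c / w $ k\<close>, the shrunk vector is the convex combination, with
  weights \<open>(1 + t) / 2\<close> and \<open>(1 - t) / 2\<close>, of \<open>w\<close> and of
  \<open>w\<close> with its sign changed at \<open>k\<close>. Both have the same gauge.\<close>

lemma symmetric_gauge_shrink_coordinate:
  assumes \<Psi>: "symmetric_gauge N \<Psi>" and w: "w \<in> carrier_vec N" and k: "k < N" and c: "0 \<le> c" "c \<le> w $ k"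
  shows "\<Psi> (vec N (\<lambda>i. if i = k then c else w $ i)) \<le> \<Psi> w"
proof (cases "w $ k = 0")
  case True
  then have "vec N (\<lambda>i. if i = k then c else w $ i) = w" using c w by (intro eq_vecI) auto
  then show ?thesis by simp
next
  case False
  then have wk: "w $ k > 0" using c by simp
  define t where "t = c / w $ k"
  have t: "0 \<le> t" "t \<le> 1" using c wk by (auto simp: t_def)
  let ?s = "\<lambda>i. if i = k then - 1 else (1 :: real)"
  let ?f = "vec N (\<lambda>i. ?s i * w $ i)"
  have f: "?f \<in> carrier_vec N" by simp
  have hom: "\<forall>v\<in>carrier_vec N. \<forall>c. \<Psi> (c \<cdot>\<^sub>v v) = \<bar>c\<bar> * \<Psi> v"
    and tri: "\<forall>v\<in>carrier_vec N. \<forall>w\<in>carrier_vec N. \<Psi> (v + w) \<le> \<Psi> v + \<Psi> w"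
    and sign: "\<forall>v\<in>carrier_vec N. \<forall>s. (\<forall>i<N. s i = 1 \<or> s i = - 1) \<longrightarrow> \<Psi> (vec N (\<lambda>i. s i * v $ i)) = \<Psi> v"
    using \<Psi> unfolding symmetric_gauge_def by blast+
  have pf: "\<Psi> ?f = \<Psi> w" by (rule sign[rule_format, OF w]) simp
  have "vec N (\<lambda>i. if i = k then c else w $ i) = ((1 + t) / 2) \<cdot>\<^sub>v w + ((1 - t) / 2) \<cdot>\<^sub>v ?f"
    using w wk by (intro eq_vecI) (auto simp: t_def field_simps)
  also have "\<Psi> \<dots> \<le> \<Psi> (((1 + t) / 2) \<cdot>\<^sub>v w) + \<Psi> (((1 - t) / 2) \<cdot>\<^sub>v ?f)"
    using w f by (intro tri[rule_format]) auto
  also have "\<dots> = \<bar>(1 + t) / 2\<bar> * \<Psi> w + \<bar>(1 - t) / 2\<bar> * \<Psi> ?f"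
    by (simp only: hom[rule_format, OF w] hom[rule_format, OF f])
  also have "\<dots> = \<Psi> w" using t pf by (simp add: field_simps)
  finally show ?thesis .
qed

lemma symmetric_gauge_mono:
  assumes \<Psi>: "symmetric_gauge N \<Psi>" and u: "u \<in> carrier_vec N" and v: "v \<in> carrier_vec N"
    and uv: "\<And>i. i < N \<Longrightarrow> 0 \<le> u $ i \<and> u $ i \<le> v $ i"
  shows "\<Psi> u \<le> \<Psi> v"
proof -
  let ?w = "\<lambda>k. vec N (\<lambda>i. if i < k then u $ i else v $ i)"
  have "k \<le> N \<Longrightarrow> \<Psi> (?w k) \<le> \<Psi> v" for k
  proof (induction k)
    case 0
    have "?w 0 = v" using v by (intro eq_vecI) auto
    then show ?case by simp
  next
    case (Suc k)
    then have k: "k < N" by simp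
    have "?w (Suc k) = vec N (\<lambda>i. if i = k then u $ k else ?w k $ i)"
      by (intro eq_vecI) (auto simp: less_Suc_eq)
    also have "\<Psi> \<dots> \<le> \<Psi> (?w k)"
      using k uv[OF k] by (intro symmetric_gauge_shrink_coordinate[OF \<Psi>]) auto
    finally show ?case using Suc by simp
  qed
  from this[of N] have "\<Psi> (?w N) \<le> \<Psi> v" by simp
  moreover have "?w N = u" using u by (intro eq_vecI) auto
  ultimately show ?thesis by simp
qed

section \<open>Half-phase truncations and the minimum\<close>

lemma t_sectorial_decomp_exists:
  assumes A: "A \<in> tensors n n p" and sec: "t_sectorial A" and n: "n > 0" and p: "p > 0"
  shows "\<exists>T d. canonical_args d \<and> sectorial_decomp (bcirc A) T d \<and>
    (\<forall>h. mat_adjoint T * mat_diag (n * p) h * T \<in> bcirc ` tensors n n p)"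
proof -
  have N: "n * p > 0" using n p by simp
  have W: "0 \<notin> numerical_range (bcirc A)" using sec by (simp add: t_sectorial_def)
  note cA = bcirc_carrier[OF A p]
  from sectorial_decomp_exists[OF N cA shift_mat_carrier W shift_mat_unitary[OF n p] bcirc_commutes_shift[OF A n p]]
  obtain T d where T: "canonical_args d" "sectorial_decomp (bcirc A) T d"
    "\<forall>h. mat_adjoint T * mat_diag (n * p) h * T * shift_mat n p = shift_mat n p * (mat_adjoint T * mat_diag (n * p) h * T)"
    by blast
  have TN: "T \<in> carrier_mat (n * p) (n * p)" using T(2) cA by (auto simp: sectorial_decomp_def Let_def)
  have "mat_adjoint T * mat_diag (n * p) h * T \<in> bcirc ` tensors n n p" for h
    by (rule commutes_shift_imp_bcirc[OF n p])
      (use T(3) TN mat_adjoint_carrier[OF TN] in \<open>auto intro!: mult_carrier_mat[of _ "n * p" "n * p" _ "n * p"]\<close>)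
  with T show ?thesis by blast
qed

lemma t_phases_eqI:
  assumes A: "A \<in> tensors n n p" and n: "n > 0" and p: "p > 0"
    and d: "canonical_args d" "sectorial_decomp (bcirc A) T d"
  shows "t_phases A = d" "t_sectorial A"
proof -
  note cA = bcirc_carrier[OF A p]
  have N: "n * p > 0" using n p by simp
  show "t_sectorial A" unfolding t_sectorial_def by (rule sectorial_decomp_imp_sectorial[OF cA d(2,1)])
  show "t_phases A = d" unfolding t_phases_def
    using d canonical_phases_unique[OF N cA] by (intro the_equality) blast+
qed

text \<open>The clause for all \<open>h\<close> is what later provides a block-circulant half-phase
  matrix, and so a minimiser.\<close>

lemma t_phases_decomp:
  assumes A: "A \<in> tensors n n p" and sec: "t_sectorial A" and n: "n > 0" and p: "p > 0"
  shows "canonical_args (t_phases A)" "t_phases A \<in> carrier_vec (n * p)"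
    and "\<exists>T. sectorial_decomp (bcirc A) T (t_phases A) \<and>
      (\<forall>h. mat_adjoint T * mat_diag (n * p) h * T \<in> bcirc ` tensors n n p)"
proof -
  obtain T d where T: "canonical_args d" "sectorial_decomp (bcirc A) T d"
    "\<forall>h. mat_adjoint T * mat_diag (n * p) h * T \<in> bcirc ` tensors n n p"
    using t_sectorial_decomp_exists[OF A sec n p] by blast
  have eq: "t_phases A = d" by (rule t_phases_eqI(1)[OF A n p T(1,2)])
  show "canonical_args (t_phases A)" using T eq by simp
  show "t_phases A \<in> carrier_vec (n * p)"
    using T(2) eq bcirc_carrier[OF A p] by (auto simp: sectorial_decomp_def Let_def)
  show "\<exists>T. sectorial_decomp (bcirc A) T (t_phases A) \<and>
      (\<forall>h. mat_adjoint T * mat_diag (n * p) h * T \<in> bcirc ` tensors n n p)"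
    using T(2,3) eq by auto
qed

lemma congruence_diag_inverse:
  fixes T X :: "complex mat"
  assumes T: "T \<in> carrier_mat N N" and X: "X \<in> carrier_mat N N" and TX: "T * X = 1\<^sub>m N" and XT: "X * T = 1\<^sub>m N"
    and fg: "\<And>i. i < N \<Longrightarrow> f i * g i = 1"
  shows "mat_adjoint T * mat_diag N f * T * (X * mat_diag N g * mat_adjoint X) = 1\<^sub>m N"
proof -
  have TH: "mat_adjoint T \<in> carrier_mat N N" and XH: "mat_adjoint X \<in> carrier_mat N N"
    using T X by (auto intro: mat_adjoint_carrier)
  note cs = mult_carrier_mat[of _ N N _ N] assoc_mult_mat[of _ N N _ N _ N]
  have "mat_adjoint T * mat_diag N f * T * (X * mat_diag N g * mat_adjoint X) =
    mat_adjoint T * (mat_diag N f * ((T * X) * (mat_diag N g * mat_adjoint X)))"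
    using T X TH XH by (simp add: cs)
  also have "\<dots> = mat_adjoint T * (mat_diag N f * mat_diag N g) * mat_adjoint X"
    unfolding TX using T X TH XH by (simp add: cs left_mult_one_mat[of _ N N] del: mat_diag_diag)
  also have "mat_diag N f * mat_diag N g = 1\<^sub>m N"
    unfolding mat_diag_diag using fg by (intro eq_matI) (auto simp: mat_diag_def)
  also have "mat_adjoint T * 1\<^sub>m N * mat_adjoint X = mat_adjoint (X * T)"
    using TH mat_adjoint_mult[OF X T] by simp
  also have "\<dots> = 1\<^sub>m N" unfolding XT by (rule mat_adjoint_one)
  finally show ?thesis .
qed

text \<open>With \<open>X = T^-1\<close> the inverse of \<open>E\<close> is \<open>X G X^H\<close>,
  where \<open>G\<close> holds the negated half phases. The outer factors cancel against those of
  \<open>A\<close>, leaving \<open>X (G D G) X^H\<close>: in \<open>G D G\<close> the two halves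
  erase the first \<open>r\<close> phases and keep the others.\<close>

lemma half_phase_truncation:
  assumes n: "n > 0" and p: "p > 0" and AC: "A \<in> C_0_pi n p" and r: "r \<le> n * p"
    and dec: "sectorial_decomp (bcirc A) T (t_phases A)"
    and E: "E \<in> tensors n n p" "bcirc E = mat_adjoint T * half_phase_diag r (t_phases A) * T"
  shows "t_invertible E" "t_sectorial E" "Tprank E \<le> r" "t_inv E *\<^sub>T A *\<^sub>T t_inv E \<in> C_0_pi n p"
    "t_phases (t_inv E *\<^sub>T A *\<^sub>T t_inv E) = drop_pad r (t_phases A)"
proof -
  define N where "N = n * p"
  define d where "d = t_phases A"
  have A: "A \<in> tensors n n p" and sec: "t_sectorial A" and d0: "\<And>i. i < N \<Longrightarrow> 0 \<le> d $ i \<and> d $ i < pi"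
    using AC by (auto simp: C_0_pi_def N_def d_def)
  have N: "N > 0" using n p by (simp add: N_def)
  have cA: "bcirc A \<in> carrier_mat N N" unfolding N_def by (rule bcirc_carrier[OF A p])
  have dN: "d \<in> carrier_vec N" and dcan: "canonical_args d"
    using t_phases_decomp(1,2)[OF A sec n p] by (simp_all add: d_def N_def)
  note dd = canonical_argsD[OF dcan dN]
  obtain X where T: "T \<in> carrier_mat N N" and X: "X \<in> carrier_mat N N" and TX: "T * X = 1\<^sub>m N"
    and XT: "X * T = 1\<^sub>m N" and Ad: "bcirc A = mat_adjoint T * mat_diag N (\<lambda>i. cis (d $ i)) * T"
    using sectorial_decomp_obtain_inverse[OF dec cA] unfolding d_def by metis
  have TH: "mat_adjoint T \<in> carrier_mat N N" and XH: "mat_adjoint X \<in> carrier_mat N N"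
    using T X by (auto intro: mat_adjoint_carrier)
  let ?h = "\<lambda>i. if i < r then cis (d $ i / 2) else 1"
  let ?g = "\<lambda>i. if i < r then cis (- d $ i / 2) else 1"
  let ?f = "\<lambda>i. if i < r then 1 else cis (d $ i)"
  have Ed: "bcirc E = mat_adjoint T * mat_diag N ?h * T"
    unfolding E(2) half_phase_diag_def d_def[symmetric] carrier_vecD[OF dN] ..
  have cE: "bcirc E \<in> carrier_mat N N" unfolding N_def by (rule bcirc_carrier[OF E(1) p])
  \<comment> \<open>These are the phases of \<open>E\<close>: nonnegativity of \<open>d\<close>
    makes the trailing zeros smallest, so the vector is sorted, and all entries stay below
    \<open>pi / 2\<close>.\<close>
  define e where "e = vec N (\<lambda>i. if i < r then d $ i / 2 else 0)"
  have ecan: "canonical_args e"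
    unfolding canonical_args_def Let_def
  proof (intro conjI allI impI)
    have dim: "dim_vec e = N" by (simp add: e_def)
    have e: "0 \<le> e $ i" "e $ i < pi / 2" if "i < N" for i using that d0[of i] by (auto simp: e_def)
    show "e $ j \<le> e $ i" if "i \<le> j" "j < dim_vec e" for i j
      using that d0[of i] dd(1)[of i j] by (auto simp: e_def)
    have "e $ 0 < pi / 2" "0 \<le> e $ 0" "e $ (N - 1) < pi / 2" "0 \<le> e $ (N - 1)" using e N by auto
    then show "e $ 0 - e $ (dim_vec e - 1) < pi" "- pi < (e $ 0 + e $ (dim_vec e - 1)) / 2"
      "(e $ 0 + e $ (dim_vec e - 1)) / 2 \<le> pi" unfolding dim using pi_gt_zero by auto
  qed
  have "mat_diag N (\<lambda>i. cis (e $ i)) = mat_diag N ?h"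
    by (intro eq_matI) (auto simp: mat_diag_def e_def)
  then have edec: "sectorial_decomp (bcirc E) T e"
    using cE T Ed dec unfolding sectorial_decomp_def Let_def by (auto simp: e_def)
  show "t_sectorial E" by (rule t_phases_eqI(2)[OF E(1) n p ecan edec])
  have "{i. i < dim_vec e \<and> e $ i \<noteq> 0} \<subseteq> {..<r}" by (auto simp: e_def split: if_splits)
  from card_mono[OF _ this] show "Tprank E \<le> r"
    unfolding Tprank_def t_phases_eqI(1)[OF E(1) n p ecan edec] by simp
  define Y where "Y = X * mat_diag N ?g * mat_adjoint X"
  have Y: "Y \<in> carrier_mat N N"
    unfolding Y_def using X XH by (auto intro!: mult_carrier_mat[of _ N N _ N])
  have "bcirc E * Y = 1\<^sub>m N"
    unfolding Ed Y_def by (rule congruence_diag_inverse[OF T X TX XT]) (auto simp: cis_mult)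
  note inv = t_inv_eqI[OF E(1) n p Y[unfolded N_def] this[unfolded N_def]]
  show "t_invertible E" by (rule inv(1))
  let ?B = "t_inv E *\<^sub>T A *\<^sub>T t_inv E"
  note P1 = bcirc_t_prod[OF inv(2) A n p]
  note P2 = bcirc_t_prod[OF P1(1) inv(2) n p]
  have B: "?B \<in> tensors n n p" "bcirc ?B = Y * bcirc A * Y" using P1 P2 inv(3) by auto
  have cB: "bcirc ?B \<in> carrier_mat N N" unfolding N_def by (rule bcirc_carrier[OF B(1) p])
  have XHTH: "mat_adjoint X * mat_adjoint T = 1\<^sub>m N"
    using mat_adjoint_mult[OF T X] TX mat_adjoint_one by simp
  note cs = mult_carrier_mat[of _ N N _ N] assoc_mult_mat[of _ N N _ N _ N]
  let ?D = "mat_diag N (\<lambda>i. cis (d $ i))" and ?G = "mat_diag N ?g" and ?F = "mat_diag N ?f"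
  have "T * bcirc ?B * mat_adjoint T = (T * X) * ?G * (mat_adjoint X * mat_adjoint T) * ?D * (T * X) * ?G * (mat_adjoint X * mat_adjoint T)"
    unfolding B(2) Y_def Ad using T X TH XH by (simp add: cs del: mat_diag_diag)
  also have "\<dots> = ?G * ?D * ?G" unfolding TX XHTH by (simp add: cs left_mult_one_mat[of _ N N] right_mult_one_mat[of _ N N] del: mat_diag_diag)
  also have "\<dots> = ?F" unfolding mat_diag_diag by (intro eq_matI) (auto simp: mat_diag_def cis_mult)
  finally have TBT: "T * bcirc ?B * mat_adjoint T = ?F" .
  \<comment> \<open>The columns of \<open>T^H\<close> form a congruence basis for \<open>B\<close>,
    because \<open>T B T^H\<close> is diagonal.\<close>
  let ?u = "\<lambda>k. mat_adjoint T *\<^sub>v unit_vec N k"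
  have u: "?u k \<in> carrier_vec N" for k by (rule mult_mat_vec_carrier[OF TH unit_vec_carrier])
  have form: "(bcirc ?B *\<^sub>v ?u j) \<bullet>c ?u i = (if i = j then ?f j else 0)" if ij: "i < N" "j < N" for i j
  proof -
    have Bu: "bcirc ?B *\<^sub>v ?u j \<in> carrier_vec N" by (rule mult_mat_vec_carrier[OF cB u])
    have "(bcirc ?B *\<^sub>v ?u j) \<bullet>c ?u i = (T *\<^sub>v (bcirc ?B *\<^sub>v ?u j)) \<bullet>c unit_vec N i"
      by (rule cscalar_adjoint[OF T Bu unit_vec_carrier, symmetric])
    also have "T *\<^sub>v (bcirc ?B *\<^sub>v ?u j) = (T * bcirc ?B * mat_adjoint T) *\<^sub>v unit_vec N j"
      using T cB TH by (simp add: assoc_mult_mat_vec[of _ N N _ N] mult_carrier_mat[of _ N N _ N])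
    also have "\<dots> = ?F *\<^sub>v unit_vec N j" unfolding TBT ..
    also have "conjugate (unit_vec N i) = (unit_vec N i :: complex vec)"
      by (intro eq_vecI) (auto simp: unit_vec_def)
    also have "(?F *\<^sub>v unit_vec N j) \<bullet> unit_vec N i = (?F *\<^sub>v unit_vec N j) $ i"
      using ij by (intro scalar_prod_right_unit) (auto intro!: mult_mat_vec_carrier[of _ N N])
    also have "\<dots> = ?F $$ (i, j)"
    proof -
      have "(?F *\<^sub>v unit_vec N j) $ i = row ?F i \<bullet> unit_vec N j"
        using ij by (intro index_mult_mat_vec) (simp add: mat_diag_def)
      also have "\<dots> = row ?F i $ j"
        using ij by (intro scalar_prod_right_unit) (auto simp: mat_diag_def)
      finally show ?thesis using ij by (simp add: mat_diag_def)
    qed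
    finally show ?thesis using ij by (simp add: mat_diag_index)
  qed
  \<comment> \<open>In \<open>?F\<close> the erased phases come first; the cyclic shift by
    \<open>r\<close> moves them to the end, where zeros belong in nonincreasing order.\<close>
  let ?k = "\<lambda>i. (i + r) mod N"
  let ?e = "drop_pad r d"
  have rN: "r \<le> N" using r by (simp add: N_def)
  have kc: "?k i = (if i + r < N then i + r else i + r - N)" if "i < N" for i
    using that rN by (simp add: mod_if)
  have kN: "?k i < N" for i using N by simp
  have kinj: "?k i = ?k j \<longleftrightarrow> i = j" if "i < N" "j < N" for i j
    unfolding kc[OF that(1)] kc[OF that(2)] using that by auto
  have fk: "?f (?k i) = cis (?e $ i)" if "i < N" for i
    unfolding kc[OF that] using that dN rN by (auto simp: drop_pad_def)
  have eN: "?e \<in> carrier_vec N" using dN by (auto simp: drop_pad_def)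
  have basis: "cong_basis (bcirc ?B) (\<lambda>i. ?u (?k i)) ?e"
    unfolding cong_basis_def
  proof (intro conjI allI impI)
    fix i j assume "i < dim_row (bcirc ?B)" "j < dim_row (bcirc ?B)"
    then have ij: "i < N" "j < N" using cB by auto
    show "(bcirc ?B *\<^sub>v ?u (?k j)) \<bullet>c ?u (?k i) = (if i = j then cis (?e $ i) else 0)"
      unfolding form[OF kN kN] kinj[OF ij] using fk[OF ij(1)] by auto
  qed (use u cB in auto)
  from cong_basis_decomp[OF cB eN basis] obtain V where V: "sectorial_decomp (bcirc ?B) V ?e" by blast
  have e0: "0 \<le> ?e $ i" "?e $ i < pi" if "i < N" for i
    using that d0 dN by (auto simp: drop_pad_def)
  have can: "canonical_args ?e"
    unfolding canonical_args_def Let_def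
  proof (intro conjI allI impI)
    have dim: "dim_vec ?e = N" using eN by simp
    show "?e $ j \<le> ?e $ i" if "i \<le> j" "j < dim_vec ?e" for i j
      using that d0[of "i + r"] dd(1)[of "i + r" "j + r"] dN by (auto simp: drop_pad_def)
    have "?e $ 0 < pi" "0 \<le> ?e $ 0" "?e $ (N - 1) < pi" "0 \<le> ?e $ (N - 1)" using e0 N by auto
    then show "?e $ 0 - ?e $ (dim_vec ?e - 1) < pi" "- pi < (?e $ 0 + ?e $ (dim_vec ?e - 1)) / 2"
      "(?e $ 0 + ?e $ (dim_vec ?e - 1)) / 2 \<le> pi" unfolding dim using pi_gt_zero by auto
  qed
  have ph: "t_phases ?B = ?e" by (rule t_phases_eqI(1)[OF B(1) n p can V])
  then show "t_phases ?B = drop_pad r (t_phases A)" by (simp add: d_def)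
  have "t_sectorial ?B" by (rule t_phases_eqI(2)[OF B(1) n p can V])
  then show "?B \<in> C_0_pi n p" using B(1) e0 unfolding C_0_pi_def N_def[symmetric] by (simp add: ph)
qed

text \<open>From \<open>A = E B E\<close> the form of \<open>A\<close> at \<open>x\<close> is the
  form of \<open>B\<close> at \<open>E x\<close> whenever \<open>E^H x = E x\<close>. In
  \<open>E = T^H D T\<close> this holds once \<open>T x\<close> vanishes at the coordinates with
  nonzero phase, since \<open>D\<close> and its adjoint then both fix \<open>T x\<close>. This costs
  at most \<open>r\<close> linear conditions.\<close>

lemma t_angle_lower_bound:
  assumes n: "n > 0" and p: "p > 0" and \<Psi>: "symmetric_gauge (n * p) \<Psi>" and AC: "A \<in> C_0_pi n p"
    and E: "E \<in> tensors n n p" "t_sectorial E" "Tprank E \<le> r"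
    and BC: "t_inv E *\<^sub>T A *\<^sub>T t_inv E \<in> C_0_pi n p"
  shows "\<Psi> (drop_pad r (t_phases A)) \<le> t_angle \<Psi> (t_inv E *\<^sub>T A *\<^sub>T t_inv E)"
proof -
  define N where "N = n * p"
  let ?B = "t_inv E *\<^sub>T A *\<^sub>T t_inv E"
  define d where "d = t_phases A"
  define b where "b = t_phases ?B"
  define e where "e = t_phases E"
  have A: "A \<in> tensors n n p" "t_sectorial A" and d0: "\<And>i. i < N \<Longrightarrow> 0 \<le> d $ i \<and> d $ i < pi"
    using AC by (auto simp: C_0_pi_def N_def d_def)
  have B: "?B \<in> tensors n n p" "t_sectorial ?B" and b0: "\<And>i. i < N \<Longrightarrow> 0 \<le> b $ i \<and> b $ i < pi"
    using BC by (auto simp: C_0_pi_def N_def b_def)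
  have cA: "bcirc A \<in> carrier_mat N N" and cB: "bcirc ?B \<in> carrier_mat N N" and cE: "bcirc E \<in> carrier_mat N N"
    unfolding N_def by (rule bcirc_carrier[OF A(1) p], rule bcirc_carrier[OF B(1) p], rule bcirc_carrier[OF E(1) p])
  have dN: "d \<in> carrier_vec N" "canonical_args d"
    using t_phases_decomp(1,2)[OF A n p] by (simp_all add: d_def N_def)
  have bN: "b \<in> carrier_vec N" "canonical_args b"
    using t_phases_decomp(1,2)[OF B n p] by (simp_all add: b_def N_def)
  have eN: "e \<in> carrier_vec N"
    using t_phases_decomp(2)[OF E(1,2) n p] by (simp add: e_def N_def)
  obtain TA where TA: "sectorial_decomp (bcirc A) TA d"
    using t_phases_decomp(3)[OF A n p] unfolding d_def by blast
  obtain TB where TB: "sectorial_decomp (bcirc ?B) TB b"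
    using t_phases_decomp(3)[OF B n p] unfolding b_def by blast
  obtain T where decE: "sectorial_decomp (bcirc E) T e"
    using t_phases_decomp(3)[OF E(1,2) n p] unfolding e_def by blast
  obtain X where T: "T \<in> carrier_mat N N" and X: "X \<in> carrier_mat N N" and TX: "T * X = 1\<^sub>m N"
    and XT: "X * T = 1\<^sub>m N" and Ed: "bcirc E = mat_adjoint T * mat_diag N (\<lambda>i. cis (e $ i)) * T"
    using sectorial_decomp_obtain_inverse[OF decE cE] by metis
  have TH: "mat_adjoint T \<in> carrier_mat N N" and XH: "mat_adjoint X \<in> carrier_mat N N"
    using T X by (auto intro: mat_adjoint_carrier)
  define Y where "Y = X * mat_diag N (\<lambda>i. cis (- e $ i)) * mat_adjoint X"
  have Y: "Y \<in> carrier_mat N N"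
    unfolding Y_def using X XH by (auto intro!: mult_carrier_mat[of _ N N _ N])
  have EY: "bcirc E * Y = 1\<^sub>m N"
    unfolding Ed Y_def by (rule congruence_diag_inverse[OF T X TX XT]) (auto simp: cis_mult)
  have YE: "Y * bcirc E = 1\<^sub>m N" by (rule mat_mult_left_right_inverse[OF cE Y EY])
  note inv = t_inv_eqI[OF E(1) n p Y[unfolded N_def] EY[unfolded N_def]]
  note P1 = bcirc_t_prod[OF inv(2) A(1) n p]
  note P2 = bcirc_t_prod[OF P1(1) inv(2) n p]
  have Bd: "bcirc ?B = Y * bcirc A * Y" using P1 P2 inv(3) by auto
  note cs = mult_carrier_mat[of _ N N _ N] assoc_mult_mat[of _ N N _ N _ N]
  have "bcirc E * bcirc ?B * bcirc E = (bcirc E * Y) * bcirc A * (Y * bcirc E)"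
    unfolding Bd using Y cA cE by (simp add: cs)
  also have "\<dots> = bcirc A" unfolding EY YE using cA by simp
  finally have EBE: "bcirc A = bcirc E * bcirc ?B * bcirc E" by simp
  have EHd: "mat_adjoint (bcirc E) = mat_adjoint T * mat_diag N (\<lambda>i. cnj (cis (e $ i))) * T"
  proof -
    have D: "mat_diag N (\<lambda>i. cis (e $ i)) \<in> carrier_mat N N" by simp
    have "mat_adjoint (bcirc E) = mat_adjoint T * mat_adjoint (mat_adjoint T * mat_diag N (\<lambda>i. cis (e $ i)))"
      unfolding Ed by (rule mat_adjoint_mult[OF mult_carrier_mat[OF TH D] T])
    also have "\<dots> = mat_adjoint T * (mat_diag N (\<lambda>i. cnj (cis (e $ i))) * T)"
      unfolding mat_adjoint_mult[OF TH D] mat_adjoint_adjoint[OF T] mat_adjoint_mat_diag ..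
    also have "\<dots> = mat_adjoint T * mat_diag N (\<lambda>i. cnj (cis (e $ i))) * T"
      by (rule assoc_mult_mat[OF TH _ T, symmetric]) simp
    finally show ?thesis .
  qed
  let ?K = "{i. i < N \<and> e $ i \<noteq> 0}"
  have card: "card ?K \<le> r" using E(3) eN unfolding Tprank_def e_def[symmetric] by simp
  \<comment> \<open>Stated for arbitrary \<open>h\<close> to serve \<open>D\<close> and its
    conjugate alike: both have entry 1 where the phase is zero.\<close>
  have diag: "(mat_adjoint T * mat_diag N h * T) *\<^sub>v x = mat_adjoint T *\<^sub>v (T *\<^sub>v x)"
    if x: "x \<in> carrier_vec N" and Tx: "\<And>k. k \<in> ?K \<Longrightarrow> (T *\<^sub>v x) $ k = 0"
      and h: "\<And>i. i < N \<Longrightarrow> e $ i = 0 \<Longrightarrow> h i = 1" for h x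
  proof -
    have TxN: "T *\<^sub>v x \<in> carrier_vec N" using T x by simp
    have "mat_diag N h *\<^sub>v (T *\<^sub>v x) = T *\<^sub>v x"
    proof (rule eq_vecI)
      fix i assume "i < dim_vec (T *\<^sub>v x)"
      then have i: "i < N" using T by simp
      have "(mat_diag N h *\<^sub>v (T *\<^sub>v x)) $ i = (\<Sum>j\<in>{0..<N}. (if i = j then h j else 0) * (T *\<^sub>v x) $ j)"
        using i TxN T unfolding mat_diag_def by (simp add: scalar_prod_def)
      also have "\<dots> = (\<Sum>j\<in>{0..<N}. if i = j then h j * (T *\<^sub>v x) $ j else 0)"
        by (intro sum.cong) auto
      also have "\<dots> = h i * (T *\<^sub>v x) $ i" using i by (subst sum.delta') auto
      also have "\<dots> = (T *\<^sub>v x) $ i" using h[OF i] Tx[of i] i by (cases "e $ i = 0") auto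
      finally show "(mat_diag N h *\<^sub>v (T *\<^sub>v x)) $ i = (T *\<^sub>v x) $ i" .
    qed (use T in \<open>simp add: mat_diag_def\<close>)
    then show ?thesis
      using T TH x TxN by (simp add: assoc_mult_mat_vec[of _ N N _ N] mult_carrier_mat[of _ N N _ N])
  qed
  have key: "(bcirc A *\<^sub>v x) \<bullet>c x = (bcirc ?B *\<^sub>v (bcirc E *\<^sub>v x)) \<bullet>c (bcirc E *\<^sub>v x)"
    if x: "x \<in> carrier_vec N" and Tx: "\<And>k. k \<in> ?K \<Longrightarrow> (T *\<^sub>v x) $ k = 0" for x
  proof -
    have Ex: "bcirc E *\<^sub>v x \<in> carrier_vec N" using cE x by simp
    have BEx: "bcirc ?B *\<^sub>v (bcirc E *\<^sub>v x) \<in> carrier_vec N" by (rule mult_mat_vec_carrier[OF cB Ex])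
    have EHx: "mat_adjoint (bcirc E) *\<^sub>v x = bcirc E *\<^sub>v x"
      unfolding EHd unfolding Ed using diag[OF x Tx] by simp
    have "bcirc A *\<^sub>v x = bcirc E *\<^sub>v (bcirc ?B *\<^sub>v (bcirc E *\<^sub>v x))"
      unfolding EBE using cB cE x by (simp add: assoc_mult_mat_vec[of _ N N _ N] mult_carrier_mat[of _ N N _ N])
    then show ?thesis using cscalar_adjoint[OF cE BEx x] EHx by simp
  qed
  \<comment> \<open>Interlacing with \<open>G\<close> the matrix of \<open>E\<close> and
    \<open>R\<close> its \<open>T\<close>; the spread condition holds because both phase vectors lie
    in \<open>[0, pi)\<close>.\<close>
  have le: "d $ (i + r) \<le> b $ i" if "i + r < N" for i
  proof (rule phase_interlacing[OF cA cB TA TB cE T _ card key])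
    show "d $ i - b $ j < pi" if "i < N" "j < N" for i j using d0[OF that(1)] b0[OF that(2)] by linarith
  qed (use that canonical_argsD(1)[OF dN(2,1)] canonical_argsD(1)[OF bN(2,1)] in auto)
  \<comment> \<open>At positions with \<open>i + r \<ge> N\<close> the padded vector is zero, and
    nonnegativity of \<open>b\<close> replaces interlacing.\<close>
  have "\<Psi> (drop_pad r d) \<le> \<Psi> b"
  proof (rule symmetric_gauge_mono[OF \<Psi>])
    fix i assume "i < n * p"
    then have "i < N" by (simp add: N_def)
    then show "0 \<le> drop_pad r d $ i \<and> drop_pad r d $ i \<le> b $ i"
      using le[of i] d0[of "i + r"] b0[of i] dN(1) by (auto simp: drop_pad_def)
  qed (use dN bN in \<open>auto simp: N_def drop_pad_def\<close>)
  then show ?thesis by (simp add: t_angle_def d_def b_def)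
qed

theorem theorem4p4:
  fixes n p r :: nat and \<Psi> :: "real vec \<Rightarrow> real" and A :: tensor
  assumes "n > 0" and "p > 0"
    and "symmetric_gauge (n * p) \<Psi>"
    and "A \<in> C_0_pi n p"
    and "r \<le> n * p"
  shows "(\<forall>E \<in> S_Tp n p A r.
            t_invertible E \<and> t_sectorial (t_inv E *\<^sub>T A *\<^sub>T t_inv E) \<and>
            t_angle \<Psi> (t_inv E *\<^sub>T A *\<^sub>T t_inv E) = \<Psi> (drop_pad r (t_phases A))) \<and>
         is_minimum
           {t_angle \<Psi> (t_inv E *\<^sub>T A *\<^sub>T t_inv E) | E.
              E \<in> tensors n n p \<and> t_sectorial E \<and>
              t_inv E *\<^sub>T A *\<^sub>T t_inv E \<in> C_0_pi n p \<and> Tprank E \<le> r}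
           (\<Psi> (drop_pad r (t_phases A)))"
proof (intro conjI ballI)
  note inj = bcirc_inj_on[OF assms(2,1), of n]
  fix E assume "E \<in> S_Tp n p A r"
  then obtain T where T: "sectorial_decomp (bcirc A) T (t_phases A)"
    and E: "E = bcirc_inv n n p (mat_adjoint T * half_phase_diag r (t_phases A) * T)"
    and M: "mat_adjoint T * half_phase_diag r (t_phases A) * T \<in> bcirc ` tensors n n p"
    by (auto simp: S_Tp_def)
  have "E \<in> tensors n n p" unfolding E bcirc_inv_def by (rule the_inv_into_into[OF inj M order_refl])
  moreover have "bcirc E = mat_adjoint T * half_phase_diag r (t_phases A) * T"
    unfolding E bcirc_inv_def by (rule f_the_inv_into_f[OF inj M])
  ultimately have *: "t_invertible E" "t_inv E *\<^sub>T A *\<^sub>T t_inv E \<in> C_0_pi n p"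
    "t_phases (t_inv E *\<^sub>T A *\<^sub>T t_inv E) = drop_pad r (t_phases A)"
    using half_phase_truncation[OF assms(1,2,4,5) T] by blast+
  show "t_invertible E" by (rule *(1))
  show "t_sectorial (t_inv E *\<^sub>T A *\<^sub>T t_inv E)" using *(2) by (simp add: C_0_pi_def)
  show "t_angle \<Psi> (t_inv E *\<^sub>T A *\<^sub>T t_inv E) = \<Psi> (drop_pad r (t_phases A))" by (simp add: t_angle_def *(3))
next
  have A: "A \<in> tensors n n p" "t_sectorial A" using assms(4) by (auto simp: C_0_pi_def)
  \<comment> \<open>Attainment needs an actual truncation; this \<open>T\<close>, adapted to the
    block shift, guarantees that its half-phase matrix is block-circulant.\<close>
  obtain T where T: "sectorial_decomp (bcirc A) T (t_phases A)"
    "\<forall>h. mat_adjoint T * mat_diag (n * p) h * T \<in> bcirc ` tensors n n p"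
    using t_phases_decomp(3)[OF A assms(1,2)] by blast
  have "dim_vec (t_phases A) = n * p" using t_phases_decomp(2)[OF A assms(1,2)] by simp
  then have "mat_adjoint T * half_phase_diag r (t_phases A) * T \<in> bcirc ` tensors n n p"
    unfolding half_phase_diag_def using T(2) by simp
  then obtain E where E: "E \<in> tensors n n p" "bcirc E = mat_adjoint T * half_phase_diag r (t_phases A) * T"
    by auto
  have "t_angle \<Psi> (t_inv E *\<^sub>T A *\<^sub>T t_inv E) = \<Psi> (drop_pad r (t_phases A))"
    using half_phase_truncation(5)[OF assms(1,2,4,5) T(1) E] by (simp add: t_angle_def)
  then show "is_minimum
           {t_angle \<Psi> (t_inv E *\<^sub>T A *\<^sub>T t_inv E) | E.
              E \<in> tensors n n p \<and> t_sectorial E \<and>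
              t_inv E *\<^sub>T A *\<^sub>T t_inv E \<in> C_0_pi n p \<and> Tprank E \<le> r}
           (\<Psi> (drop_pad r (t_phases A)))"
    unfolding is_minimum_def
    using E(1) half_phase_truncation(2-4)[OF assms(1,2,4,5) T(1) E] t_angle_lower_bound[OF assms(1-4)]
    by force
qed

end
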